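(* Let $n>3$ and let $p$ be a permutation pattern. If $p$ is periodic for $3$, then $p$ is periodic for $n$.
   Context: An affine permutation of size $n$ is a bijection $w:\mathbb{Z}\to\mathbb{Z}$ with $w(i+n)=w(i)+n$ for all $i$ and $w(1)+\cdots+w(n)=\binom{n+1}{2}$; $\widetilde{S}_n$ is the group of these, generated by $s_0,\dots,s_{n-1}$ where $ws_i$ swaps the values at positions $i+mn$ and $i+1+mn$ for all $m$; $\ell(w)$ is the minimal number of generators in a factorization. $w$ contains $p\in S_k$ if there exist integers $i_1<\cdots<i_k$ with $w(i_1),\dots,w(i_k)$ in the same relative order as $p_1,\dots,p_k$, otherwise avoids $p$. With $F_{p,n}(x)=\sum_{w\in\widetilde{S}_n,\,w\text{ avoids }p}x^{\ell(w)}=\sum_ia_ix^i$, $p$ is periodic for $n$ if there exist $N\ge1$ and $i_0$ with $a_i=a_{i-N}$ for all $i\ge i_0$. *)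

theory Defs
  imports Main
begin

definition affine_perm :: "nat \<Rightarrow> (int \<Rightarrow> int) \<Rightarrow> bool" where
  "affine_perm n w \<longleftrightarrow> bij w \<and> (\<forall>i. w (i + int n) = w i + int n)
     \<and> (\<Sum>i = 1..int n. w i) = int ((n + 1) choose 2)"

text \<open>The generator s_i (as a map on positions): it swaps i+mn and i+1+mn for all m.
  Then w \<circ> s_i swaps the values of w at positions i+mn and i+1+mn.\<close>
definition gen :: "nat \<Rightarrow> nat \<Rightarrow> int \<Rightarrow> int" where
  "gen n i j = (if j mod int n = int i then j + 1
                else if j mod int n = (int i + 1) mod int n then j - 1 else j)"

definition gen_prod :: "nat \<Rightarrow> nat list \<Rightarrow> int \<Rightarrow> int" where
  "gen_prod n is = foldr (\<lambda>i f. gen n i \<circ> f) is id"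

definition aff_length :: "nat \<Rightarrow> (int \<Rightarrow> int) \<Rightarrow> nat" where
  "aff_length n w = (LEAST k. \<exists>is. length is = k \<and> set is \<subseteq> {0..<n} \<and> w = gen_prod n is)"

definition is_pattern :: "nat list \<Rightarrow> bool" where
  "is_pattern p \<longleftrightarrow> distinct p \<and> set p = {1..length p}"

definition contains :: "(int \<Rightarrow> int) \<Rightarrow> nat list \<Rightarrow> bool" where
  "contains w p \<longleftrightarrow> (\<exists>ix :: nat \<Rightarrow> int.
      (\<forall>a b. a < b \<and> b < length p \<longrightarrow> ix a < ix b) \<and>
      (\<forall>a b. a < length p \<and> b < length p \<longrightarrow> (w (ix a) < w (ix b) \<longleftrightarrow> p ! a < p ! b)))"

definition avoids :: "(int \<Rightarrow> int) \<Rightarrow> nat list \<Rightarrow> bool" where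
  "avoids w p \<longleftrightarrow> \<not> contains w p"

definition avoid_coeff :: "nat list \<Rightarrow> nat \<Rightarrow> nat \<Rightarrow> nat" where
  "avoid_coeff p n i = card {w. affine_perm n w \<and> avoids w p \<and> aff_length n w = i}"

text \<open>Periodicity: eventually a_{i} = a_{i-N}; stated equivalently as a_{i+N} = a_i
  for all i \<ge> i0 (avoids truncated natural subtraction).\<close>
definition periodic_for :: "nat list \<Rightarrow> nat \<Rightarrow> bool" where
  "periodic_for p n \<longleftrightarrow> (\<exists>N i0. N \<ge> 1 \<and> (\<forall>i \<ge> i0. avoid_coeff p n (i + N) = avoid_coeff p n i))"

end

theory Submission
  imports Defs Complex_Main "HOL-Library.FuncSet"
begin

text \<open>
  Fix the residues modulo \<open>n\<close> of the window \<open>w 0, \<dots>, w (n - 1)\<close>; then \<open>w\<close> is described by the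
  integer vector \<open>q c = w c div n\<close>. Choosing the residue classes used by an occurrence of \<open>p\<close>, what
  remains is a system of difference constraints, so containment of \<open>p\<close> is a Boolean combination of
  sign conditions on finitely many affine forms in the differences \<open>q c - q 0\<close>. The length is
  \<open>\<Sum>\<bar>(w j - w i) div n\<bar>\<close> over \<open>0 \<le> i < j < n\<close>, hence piecewise affine in \<open>q\<close>.

  If \<open>p\<close> is periodic for 3, the number of avoiders of each length is bounded, which forces every
  avoider in the two-dimensional case \<open>n = 3\<close> to lie within bounded distance of finitely many lines.
  For larger \<open>n\<close>, restricting an avoider to the residue classes \<open>0\<close>, \<open>i\<close>, \<open>j\<close> gives an avoider for 3, so
  any two of the numbers \<open>q i - q 0\<close> satisfy one of finitely many nontrivial linear relations up to
  bounded error. Hence all avoiders lie on finitely many rays. Along a ray containment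
  of \<open>p\<close> is eventually constant and the length is eventually affine with positive slope, and so
  the number of avoiders of length \<open>i\<close> is eventually periodic in \<open>i\<close>.
\<close>

section \<open>Lengths of affine permutations\<close>

text \<open>The normalization of the sum is left out because neither standardizing three residue
  classes nor adding a constant preserves it; \<open>affine_perm_normalize\<close> restores it at
  the end.\<close>

definition periodic_bij :: "nat \<Rightarrow> (int \<Rightarrow> int) \<Rightarrow> bool" where
  "periodic_bij n w \<longleftrightarrow> bij w \<and> (\<forall>i. w (i + int n) = w i + int n)"

text \<open>Shi's formula for the length: for \<open>i < j\<close> in one window, the absolute value
  of the floor counts the inversions between the classes of \<open>i\<close> and \<open>j\<close>,
  up to translation by \<open>n\<close>. The start \<open>k\<close> is variable so that each
  generator can be studied in a window that begins at the place where it acts.\<close>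

definition window_inv :: "nat \<Rightarrow> int \<Rightarrow> (int \<Rightarrow> int) \<Rightarrow> int" where
  "window_inv n k w =
     (\<Sum>i\<in>{k..<k + int n}. \<Sum>j\<in>{i<..<k + int n}. \<bar>(w j - w i) div int n\<bar>)"

section \<open>Periodic bijections, their residues, and invariance of the inversion count under
  sliding\<close>

lemma periodic_shift:
  fixes w :: "int \<Rightarrow> int"
  assumes "\<And>i. w (i + int n) = w i + int n"
  shows "w (i + int n * m) = w i + int n * m"
proof (induction m rule: int_induct[where k = 0])
  case base then show ?case by simp
next
  case (step1 m) then show ?case using assms[of "i + int n * m"] by (simp add: algebra_simps)
next
  case (step2 m) then show ?case using assms[of "i + int n * (m - 1)"] by (simp add: algebra_simps)
qed

lemma periodic_window:
  fixes w :: "int \<Rightarrow> int"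
  assumes "\<And>i. w (i + int n) = w i + int n"
  shows "w x = int n * (x div int n) + w (x mod int n)"
  using periodic_shift[of w n "x mod int n" "x div int n", OF assms]
  by (simp add: add.commute)

lemma affine_perm_periodic_bij: "affine_perm n w \<Longrightarrow> periodic_bij n w"
  by (simp add: affine_perm_def periodic_bij_def)

lemma periodic_bijD:
  assumes "periodic_bij n w"
  shows "bij w" "\<And>i. w (i + int n) = w i + int n"
  using assms by (auto simp: periodic_bij_def)

lemma periodic_bij_inj_mod:
  assumes "periodic_bij n w" "n > 0" "w x mod int n = w y mod int n"
  shows "x mod int n = y mod int n"
proof -
  have "w x = w y + int n * ((w x div int n) - (w y div int n))"
    using assms(3) mult_div_mod_eq[of "int n" "w x"] mult_div_mod_eq[of "int n" "w y"]
    unfolding right_diff_distrib by linarith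
  also have "\<dots> = w (y + int n * ((w x div int n) - (w y div int n)))"
    using periodic_shift[of w n, OF periodic_bijD(2)[OF assms(1)]] by simp
  finally have "x = y + int n * ((w x div int n) - (w y div int n))"
    using periodic_bijD(1)[OF assms(1)] by (meson bij_is_inj injD)
  then show ?thesis
    using mod_mult_self2[of y "int n" "w x div int n - w y div int n"] by presburger
qed

text \<open>One window decides: an injective self-map of the finite set of residues is onto, and
  periodicity lifts both injectivity and surjectivity to all integers.\<close>

lemma periodic_bijI:
  fixes w :: "int \<Rightarrow> int"
  assumes n: "n > 0" and per: "\<And>i. w (i + int n) = w i + int n"
    and inj: "\<And>c d. 0 \<le> c \<Longrightarrow> c < int n \<Longrightarrow> 0 \<le> d \<Longrightarrow> d < int n \<Longrightarrow>
      w c mod int n = w d mod int n \<Longrightarrow> c = d"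
  shows "periodic_bij n w"
proof -
  have wx: "w x = int n * (x div int n) + w (x mod int n)" for x
    using periodic_window[of w n, OF per] .
  have "inj w"
  proof (rule injI)
    fix x y assume eq: "w x = w y"
    have "w (x mod int n) mod int n = w (y mod int n) mod int n"
      using arg_cong[OF eq, of "\<lambda>t. t mod int n"] wx[of x] wx[of y] by simp
    then have m: "x mod int n = y mod int n"
      by (rule inj[rotated 4]) (use n in auto)
    then have "int n * (x div int n) = int n * (y div int n)"
      using eq wx[of x] wx[of y] by simp
    then show "x = y"
      using m mult_div_mod_eq[of "int n" x] mult_div_mod_eq[of "int n" y] by linarith
  qed
  moreover have "surj w"
  proof -
    let ?I = "{0..<int n}"
    have io: "inj_on (\<lambda>c. w c mod int n) ?I" by (rule inj_onI, rule inj) auto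
    have img: "(\<lambda>c. w c mod int n) ` ?I = ?I"
      by (rule endo_inj_surj) (use io n in auto)
    have ex: "\<exists>c\<in>?I. y mod int n = w c mod int n" for y
    proof -
      have "y mod int n \<in> ?I" using n by simp
      then show ?thesis using img by (metis (no_types, lifting) imageE)
    qed
    have "\<exists>x. y = w x" for y
    proof -
      obtain c where c: "y mod int n = w c mod int n" using ex by blast
      have "y = w c + int n * (y div int n - w c div int n)"
        using c mult_div_mod_eq[of "int n" y] mult_div_mod_eq[of "int n" "w c"]
        unfolding right_diff_distrib by linarith
      also have "\<dots> = w (c + int n * (y div int n - w c div int n))"
        using periodic_shift[of w n, OF per] by simp
      finally show ?thesis by blast
    qed
    then show ?thesis by (auto simp: surj_def)
  qed
  ultimately show ?thesis using per by (simp add: periodic_bij_def bij_def)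
qed

text \<open>The offset \<open>- 1\<close> is the source of the change by exactly one when a
  generator acts, and it cancels against a full period when the window slides.\<close>

lemma div_minus_not_dvd:
  fixes d :: int
  assumes "n > 0" "\<not> n dvd d"
  shows "(- d) div n = - (d div n) - 1"
proof -
  have r: "0 < d mod n" "d mod n < n"
    using assms pos_mod_sign[of n d] pos_mod_bound[of n d]
    by (auto simp: dvd_eq_mod_eq_0 order_le_less simp del: pos_mod_sign pos_mod_bound)
  have "- d = n * (- (d div n) - 1) + (n - d mod n)"
    using mult_div_mod_eq[of n d] by (simp add: algebra_simps)
  then show ?thesis using r
    by (intro int_div_pos_eq[of _ _ _ "n - d mod n"]) auto
qed

lemma periodic_bij_not_dvd:
  assumes "periodic_bij n w" "n > 0" "i < j" "j < i + int n"
  shows "\<not> int n dvd w j - w i"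
proof
  assume "int n dvd w j - w i"
  then have "w j mod int n = w i mod int n" by (simp add: mod_eq_dvd_iff)
  then have "j mod int n = i mod int n" using periodic_bij_inj_mod assms by blast
  then have "int n dvd j - i" by (simp add: mod_eq_dvd_iff)
  then show False using assms(3,4) zdvd_not_zless[of "j - i" "int n"] by auto
qed

lemma window_inv_split:
  assumes "n > 0"
  shows "window_inv n k w = (\<Sum>j\<in>{k<..<k + int n}. \<bar>(w j - w k) div int n\<bar>)
     + (\<Sum>i\<in>{k<..<k + int n}. \<Sum>j\<in>{i<..<k + int n}. \<bar>(w j - w i) div int n\<bar>)"
proof -
  have "{k..<k + int n} = insert k {k<..<k + int n}" using assms by auto
  then show ?thesis by (simp add: window_inv_def)
qed

text \<open>Position \<open>k\<close> leaves the window and \<open>k + int n\<close> enters, now as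
  the last member of each of its pairs. Reversing the difference contributes \<open>- 1\<close> to
  the floor and the extra period contributes \<open>+ 1\<close>, so the floor only changes
  sign.\<close>

lemma window_inv_Suc:
  assumes w: "periodic_bij n w" and n: "n > 0"
  shows "window_inv n (k + 1) w = window_inv n k w"
proof -
  let ?M = "{k<..<k + int n}"
  let ?t = "\<lambda>i j. \<bar>(w j - w i) div int n\<bar>"
  have t: "?t i (k + int n) = ?t k i" if "i \<in> ?M" for i
  proof -
    have nd: "\<not> int n dvd w i - w k" using periodic_bij_not_dvd[OF w n] that by auto
    have "(w (k + int n) - w i) div int n = (- (w i - w k) + int n * 1) div int n"
      using periodic_bijD(2)[OF w, of k] by (simp add: algebra_simps)
    also have "\<dots> = (- (w i - w k)) div int n + 1"
      using n by (subst div_mult_self2) auto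
    also have "\<dots> = - ((w i - w k) div int n)"
      using div_minus_not_dvd[OF _ nd] n by simp
    finally show ?thesis by simp
  qed
  have "{k + 1..<k + 1 + int n} = insert (k + int n) ?M" using n by auto
  then have "window_inv n (k + 1) w
     = (\<Sum>j\<in>{k + int n<..<k + 1 + int n}. ?t (k + int n) j)
       + (\<Sum>i\<in>?M. \<Sum>j\<in>{i<..<k + 1 + int n}. ?t i j)"
    by (simp add: window_inv_def)
  also have "{k + int n<..<k + 1 + int n} = {}" by auto
  also have "(\<Sum>i\<in>?M. \<Sum>j\<in>{i<..<k + 1 + int n}. ?t i j)
     = (\<Sum>i\<in>?M. ?t k i + (\<Sum>j\<in>{i<..<k + int n}. ?t i j))"
  proof (rule sum.cong[OF refl])
    fix i assume i: "i \<in> ?M"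
    then have "{i<..<k + 1 + int n} = insert (k + int n) {i<..<k + int n}" by auto
    then show "(\<Sum>j\<in>{i<..<k + 1 + int n}. ?t i j) = ?t k i + (\<Sum>j\<in>{i<..<k + int n}. ?t i j)"
      using t[OF i] by simp
  qed
  finally show ?thesis using window_inv_split[OF n, of k w] by (simp add: sum.distrib)
qed

lemma window_inv_nat:
  assumes "periodic_bij n w" "n > 0"
  shows "window_inv n (int m) w = window_inv n 0 w"
proof (induction m)
  case (Suc m)
  then show ?case using window_inv_Suc[OF assms, of "int m"] by (simp add: add.commute)
qed simp

section \<open>The generators and their effect on the inversion count\<close>

lemma gen_invol:
  assumes "n \<ge> 2" "i < n"
  shows "gen n i (gen n i x) = x"
proof -
  \<comment> \<open>For \<open>i = n - 1\<close> the second residue wraps around to 0; it still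
    differs from \<open>i\<close> because \<open>n \<ge> 2\<close>.\<close>
  have ne: "(int i + 1) mod int n \<noteq> int i"
  proof (cases "i + 1 = n")
    case True
    then have "(int i + 1) mod int n = 0" by (metis (no_types) mod_self of_nat_1 of_nat_add)
    then show ?thesis using True assms by auto
  next
    case False
    then have "(int i + 1) mod int n = int i + 1" using assms by (intro mod_pos_pos_trivial) auto
    then show ?thesis by simp
  qed
  consider "x mod int n = int i" | "x mod int n = (int i + 1) mod int n"
    | "x mod int n \<noteq> int i" "x mod int n \<noteq> (int i + 1) mod int n" by blast
  then show ?thesis
  proof cases
    case 1
    then have "(x + 1) mod int n = (int i + 1) mod int n"
      using mod_add_left_eq[of x "int n" 1] by simp
    then show ?thesis using 1 ne by (simp add: gen_def)
  next
    case 2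
    then have "(x - 1) mod int n = (int i + 1 - 1) mod int n" by (intro mod_diff_cong) auto
    then have "(x - 1) mod int n = int i" using assms by simp
    then show ?thesis using 2 ne by (simp add: gen_def)
  next
    case 3
    then show ?thesis by (simp add: gen_def)
  qed
qed

lemma gen_periodic_bij:
  assumes "n \<ge> 2" "i < n"
  shows "periodic_bij n (gen n i)"
proof -
  have "bij (gen n i)"
    using gen_invol[OF assms] by (intro o_bij[of "gen n i"]) (auto simp: fun_eq_iff)
  then show ?thesis by (simp add: periodic_bij_def gen_def)
qed

lemma periodic_bij_comp:
  "periodic_bij n u \<Longrightarrow> periodic_bij n w \<Longrightarrow> periodic_bij n (u \<circ> w)"
  by (auto simp: periodic_bij_def bij_comp)

lemma gen_on_window:
  assumes n: "n \<ge> 2" "i < n"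
  shows "gen n i (int i) = int i + 1" "gen n i (int i + 1) = int i"
    "\<And>j. int i + 1 < j \<Longrightarrow> j < int i + int n \<Longrightarrow> gen n i j = j"
proof -
  show 1: "gen n i (int i) = int i + 1" using n by (simp add: gen_def)
  show "gen n i (int i + 1) = int i" using gen_invol[OF n, of "int i"] 1 by simp
  fix j assume j: "int i + 1 < j" "j < int i + int n"
  have "j mod int n \<noteq> int i"
  proof
    assume "j mod int n = int i"
    then have "j mod int n = int i mod int n" using n by simp
    then have "int n dvd j - int i" by (simp add: mod_eq_dvd_iff)
    then show False using zdvd_not_zless[of "j - int i" "int n"] j by auto
  qed
  moreover have "j mod int n \<noteq> (int i + 1) mod int n"
  proof
    assume "j mod int n = (int i + 1) mod int n"
    then have "int n dvd j - (int i + 1)" by (simp add: mod_eq_dvd_iff)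
    then show False using zdvd_not_zless[of "j - (int i + 1)" "int n"] j by auto
  qed
  ultimately show "gen n i j = j" by (simp add: gen_def)
qed

text \<open>In the window that starts at \<open>int i\<close> the generator exchanges the first two
  entries and fixes the others. The terms with the remaining positions are permuted; in the term of
  the exchanged pair the floor \<open>d\<close> becomes \<open>- d - 1\<close>, and the sign of
  \<open>d\<close> tells whether there is an ascent.\<close>

lemma window_inv_gen:
  assumes w: "periodic_bij n w" and n: "n \<ge> 2" "i < n"
  shows "window_inv n 0 (w \<circ> gen n i)
    = window_inv n 0 w + (if w (int i) < w (int i + 1) then 1 else - 1)"
proof -
  let ?k = "int i"
  let ?w = "w \<circ> gen n i"
  let ?R = "{?k + 1<..<?k + int n}"
  have n0: "n > 0" using n by simp
  have split: "window_inv n ?k u = \<bar>(u (?k + 1) - u ?k) div int n\<bar>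
      + (\<Sum>j\<in>?R. \<bar>(u j - u ?k) div int n\<bar>) + (\<Sum>j\<in>?R. \<bar>(u j - u (?k + 1)) div int n\<bar>)
      + (\<Sum>i\<in>?R. \<Sum>j\<in>{i<..<?k + int n}. \<bar>(u j - u i) div int n\<bar>)" for u
  proof -
    have "{?k<..<?k + int n} = insert (?k + 1) ?R" using n by auto
    then show ?thesis by (simp add: window_inv_split[OF n0])
  qed
  have R: "?w j = w j" if "j \<in> ?R" for j
    using gen_on_window(3)[OF n] that by simp
  have e: "?w ?k = w (?k + 1)" "?w (?k + 1) = w ?k"
    using gen_on_window(1,2)[OF n] by auto
  have "(\<Sum>i\<in>?R. \<Sum>j\<in>{i<..<?k + int n}. \<bar>(?w j - ?w i) div int n\<bar>)
      = (\<Sum>i\<in>?R. \<Sum>j\<in>{i<..<?k + int n}. \<bar>(w j - w i) div int n\<bar>)"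
    by (intro sum.cong refl) (use R in auto)
  moreover have "(\<Sum>j\<in>?R. \<bar>(?w j - c) div int n\<bar>) = (\<Sum>j\<in>?R. \<bar>(w j - c) div int n\<bar>)" for c
    by (intro sum.cong refl) (use R in auto)
  ultimately have eq: "window_inv n ?k ?w - window_inv n ?k w
      = \<bar>(w ?k - w (?k + 1)) div int n\<bar> - \<bar>(w (?k + 1) - w ?k) div int n\<bar>"
    unfolding split by (simp only: e)
  let ?d = "w (?k + 1) - w ?k"
  have nd: "\<not> int n dvd ?d"
    using periodic_bij_not_dvd[OF w n0, of ?k "?k + 1"] n by auto
  have m: "(w ?k - w (?k + 1)) div int n = - (?d div int n) - 1"
    using div_minus_not_dvd[OF _ nd] n0 by simp
  have "?d div int n \<ge> 0 \<longleftrightarrow> w ?k < w (?k + 1)"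
  proof -
    have "?d \<noteq> 0" using nd by auto
    then show ?thesis using n0 by (auto simp: pos_imp_zdiv_nonneg_iff)
  qed
  then have "window_inv n ?k ?w - window_inv n ?k w = (if w ?k < w (?k + 1) then 1 else - 1)"
    unfolding eq m by auto
  then show ?thesis
    using window_inv_nat[OF w n0, of i]
      window_inv_nat[OF periodic_bij_comp[OF w gen_periodic_bij[OF n]] n0, of i] by simp
qed

lemma window_inv_nonneg: "window_inv n k w \<ge> 0"
  unfolding window_inv_def by (intro sum_nonneg) auto

lemma sum_window_Suc:
  fixes w :: "int \<Rightarrow> int"
  assumes per: "\<And>i. w (i + int n) = w i + int n"
  shows "(\<Sum>i\<in>{k + 1..<k + 1 + int n}. w i) = (\<Sum>i\<in>{k..<k + int n}. w i) + int n"
proof (cases "n = 0")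
  case False
  have "{k + 1..<k + 1 + int n} = insert (k + int n) {k<..<k + int n}" using False by auto
  moreover have "{k..<k + int n} = insert k {k<..<k + int n}" using False by auto
  ultimately show ?thesis using per[of k] by simp
qed simp

lemma gen_prod_snoc: "gen_prod n (is @ [i]) = gen_prod n is \<circ> gen n i"
  by (induction "is") (simp_all add: gen_prod_def comp_assoc)

lemma window_inv_id: "window_inv n 0 id = 0"
    unfolding window_inv_def by (intro sum.neutral ballI) (simp add: div_pos_pos_trivial)

text \<open>Lower bound for the word length: the count starts at 0 for the identity and each letter
  raises it by at most one.\<close>

lemma gen_prod_window_inv:
  assumes "n \<ge> 2" "set is \<subseteq> {0..<n}"
  shows "periodic_bij n (gen_prod n is) \<and> window_inv n 0 (gen_prod n is) \<le> int (length is)"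
  using assms(2)
proof (induction "is" rule: rev_induct)
  case Nil
  have "gen_prod n [] = id" by (simp add: gen_prod_def)
  moreover have "periodic_bij n id" by (simp only: periodic_bij_def bij_id id_apply simp_thms)
  ultimately show ?case using window_inv_id[of n] by (simp only: list.size of_nat_0 order_refl simp_thms)
next
  case (snoc i "is")
  then have i: "i < n" and *: "periodic_bij n (gen_prod n is)"
    "window_inv n 0 (gen_prod n is) \<le> int (length is)" by auto
  then show ?case
    unfolding gen_prod_snoc
    using periodic_bij_comp[OF *(1) gen_periodic_bij[OF assms(1) i]]
      window_inv_gen[OF *(1) assms(1) i]
    by (auto simp del: comp_apply)
qed

section \<open>The normalized sum, sorting words, and the length formula\<close>

lemma sum_window_nat:
  fixes w :: "int \<Rightarrow> int"
  assumes "\<And>i. w (i + int n) = w i + int n"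
  shows "(\<Sum>i\<in>{int m..<int m + int n}. w i) = (\<Sum>i\<in>{0..<int n}. w i) + int m * int n"
proof (induction m)
  case (Suc m)
  then show ?case using sum_window_Suc[of w n "int m", OF assms]
    by (simp add: algebra_simps)
qed simp

lemma sum_upto_int: "(\<Sum>i = 1..int n. i) = int ((n + 1) choose 2)"
proof (induction n)
  case (Suc n)
  have "{1..int (Suc n)} = insert (int n + 1) {1..int n}" by auto
  then show ?case using Suc by (simp add: numeral_2_eq_2)
qed (simp add: numeral_2_eq_2)

text \<open>Moves the normalization to the window \<open>0, ..., n - 1\<close>, whose positions are
  the canonical residues. Passing from one window to the other adds \<open>n\<close> to the sum for
  \<open>w\<close> and for the identity alike.\<close>

lemma affine_perm_iff:
  "affine_perm n w \<longleftrightarrow>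
     periodic_bij n w \<and> (\<Sum>i\<in>{0..<int n}. w i) = (\<Sum>i\<in>{0..<int n}. i)"
proof -
  have I: "{1..int n} = {int 1..<int 1 + int n}" by auto
  have "(\<Sum>i = 1..int n. i) = (\<Sum>i\<in>{0..<int n}. i) + int n"
    unfolding I using sum_window_nat[of "\<lambda>i. i" n 1] by simp
  moreover have "(\<Sum>i = 1..int n. w i) = (\<Sum>i\<in>{0..<int n}. w i) + int n" if "periodic_bij n w"
    unfolding I using sum_window_nat[of w n 1] periodic_bijD(2)[OF that] by simp
  ultimately show ?thesis
    using sum_upto_int[of n] by (auto simp: affine_perm_def periodic_bij_def)
qed

lemma affine_perm_comp_gen:
  assumes w: "affine_perm n w" and n: "n \<ge> 2" "i < n"
  shows "affine_perm n (w \<circ> gen n i)"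
proof -
  let ?k = "int i"
  let ?R = "{?k + 1<..<?k + int n}"
  have pw: "periodic_bij n w" using w by (rule affine_perm_periodic_bij)
  have pg: "periodic_bij n (w \<circ> gen n i)"
    using periodic_bij_comp[OF pw gen_periodic_bij[OF n]] .
  have W: "{?k..<?k + int n} = insert ?k (insert (?k + 1) ?R)" using n by auto
  have "(\<Sum>j\<in>?R. (w \<circ> gen n i) j) = (\<Sum>j\<in>?R. w j)"
    by (intro sum.cong refl) (use gen_on_window(3)[OF n] in auto)
  then have "(\<Sum>j\<in>{?k..<?k + int n}. (w \<circ> gen n i) j) = (\<Sum>j\<in>{?k..<?k + int n}. w j)"
    unfolding W using gen_on_window(1,2)[OF n] by simp
  then have "(\<Sum>j\<in>{0..<int n}. (w \<circ> gen n i) j) = (\<Sum>j\<in>{0..<int n}. w j)"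
    using sum_window_nat[of w n i, OF periodic_bijD(2)[OF pw]]
      sum_window_nat[of "w \<circ> gen n i" n i, OF periodic_bijD(2)[OF pg]] by simp
  then show ?thesis using w pg by (simp add: affine_perm_iff)
qed

text \<open>Ascents everywhere make \<open>w\<close> strictly increasing. A skipped value would need
  a preimage strictly between two consecutive integers, so \<open>w\<close> is a translation, and
  the normalized sum allows only the trivial one.\<close>

lemma affine_perm_no_descent:
  assumes w: "affine_perm n w" and n: "n > 0"
    and nd: "\<And>i. i < n \<Longrightarrow> w (int i) < w (int i + 1)"
  shows "w = id"
proof -
  have pw: "periodic_bij n w" using w by (rule affine_perm_periodic_bij)
  note per = periodic_shift[of w n, OF periodic_bijD(2)[OF pw]]
  have lt: "w x < w (x + 1)" for x
  proof -
    have "w (x mod int n) < w (x mod int n + 1)"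
      using nd[of "nat (x mod int n)"] n by (simp add: nat_less_iff)
    then have "w (x mod int n + int n * (x div int n)) < w (x mod int n + 1 + int n * (x div int n))"
      by (simp only: per)
    moreover have "x mod int n + int n * (x div int n) = x"
      "x mod int n + 1 + int n * (x div int n) = x + 1"
      using mod_mult_div_eq[of x "int n"] by linarith+
    ultimately show ?thesis by simp
  qed
  have lt': "w x < w (x + 1 + int m)" for x m
  proof (induction m)
    case (Suc m)
    then show ?case using lt[of "x + 1 + int m"] by (simp add: algebra_simps)
  qed (use lt[of x] in simp)
  have smono: "w x < w y" if "x < y" for x y
    using lt'[of x "nat (y - x - 1)"] that by simp
  have step: "w (x + 1) = w x + 1" for x
  proof (rule ccontr)
    assume ne: "w (x + 1) \<noteq> w x + 1"
    obtain y where y: "w y = w x + 1"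
      using periodic_bijD(1)[OF pw] by (metis bij_pointE)
    have "w x < w y" "w y < w (x + 1)" using y ne lt[of x] by auto
    then have "x < y" "y < x + 1"
      using smono[of y x] smono[of "x + 1" y] by (metis less_irrefl linorder_less_linear less_asym)+
    then show False by simp
  qed
  have wx: "w x = w 0 + x" for x
  proof (induction x rule: int_induct[where k = 0])
    case (step1 i) then show ?case using step[of i] by simp
  next
    case (step2 i) then show ?case using step[of "i - 1"] by simp
  qed simp
  have "(\<Sum>i\<in>{0..<int n}. w i) = (\<Sum>i\<in>{0..<int n}. w 0 + i)"
    by (intro sum.cong refl) (rule wx)
  then have "int n * w 0 = 0" using w by (simp add: affine_perm_iff sum.distrib)
  then have w0: "w 0 = 0" using n by simp
  show ?thesis
  proof
    fix x show "w x = id x" using wx[of x] w0 by simp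
  qed
qed

text \<open>Upper bound for the word length, by bubble sort: as long as there is a descent, the
  corresponding generator lowers the count by one; without descents only the identity is
  left.\<close>

lemma affine_perm_word:
  assumes "affine_perm n w" "n \<ge> 2"
  shows "\<exists>is. int (length is) = window_inv n 0 w \<and> set is \<subseteq> {0..<n} \<and> w = gen_prod n is"
  using assms(1)
proof (induction "nat (window_inv n 0 w)" arbitrary: w rule: less_induct)
  case less
  show ?case
  proof (cases "\<exists>i<n. \<not> w (int i) < w (int i + 1)")
    case True
    then obtain i where i: "i < n" "\<not> w (int i) < w (int i + 1)" by blast
    let ?w = "w \<circ> gen n i"
    have inv: "window_inv n 0 ?w = window_inv n 0 w - 1"
      using window_inv_gen[OF affine_perm_periodic_bij[OF less.prems] assms(2) i(1)] i(2) by simp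
    then have "nat (window_inv n 0 ?w) < nat (window_inv n 0 w)"
      using window_inv_nonneg[of n 0 ?w] by linarith
    then obtain is' where is': "int (length is') = window_inv n 0 ?w" "set is' \<subseteq> {0..<n}"
      "?w = gen_prod n is'"
      using less.hyps affine_perm_comp_gen[OF less.prems assms(2) i(1)] by blast
    have "w = ?w \<circ> gen n i" using gen_invol[OF assms(2) i(1)] by (auto simp: fun_eq_iff)
    then have "w = gen_prod n (is' @ [i])" unfolding gen_prod_snoc using is'(3) by simp
    then show ?thesis using is' inv i(1) by (intro exI[of _ "is' @ [i]"]) auto
  next
    case False
    then have "w = id" using affine_perm_no_descent[OF less.prems] assms(2) by auto
    then show ?thesis
      by (intro exI[of _ "[]"]) (auto simp: window_inv_id gen_prod_def)
  qed
qed

lemma aff_length_eq_window_inv: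
  assumes "affine_perm n w" "n \<ge> 2"
  shows "int (aff_length n w) = window_inv n 0 w"
proof -
  obtain "is" where is0: "int (length is) = window_inv n 0 w" "set is \<subseteq> {0..<n}" "w = gen_prod n is"
    using affine_perm_word[OF assms] by blast
  have "aff_length n w = length is"
    unfolding aff_length_def
  proof (rule Least_equality)
    show "\<exists>js. length js = length is \<and> set js \<subseteq> {0..<n} \<and> w = gen_prod n js"
      using is0 by blast
    fix k assume "\<exists>js. length js = k \<and> set js \<subseteq> {0..<n} \<and> w = gen_prod n js"
    then show "length is \<le> k"
      using gen_prod_window_inv[OF assms(2)] is0(1) by (metis of_nat_le_iff)
  qed
  then show ?thesis using is0 by simp
qed

text \<open>There are finitely many words of given length. This makes the cardinality in
  \<open>avoid_coeff\<close> a genuine count, as \<open>card\<close> of an infinite set would be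
  0.\<close>

lemma finite_affine_perm_length:
  assumes "n \<ge> 2"
  shows "finite {w. affine_perm n w \<and> aff_length n w = i}"
proof (rule finite_subset)
  show "{w. affine_perm n w \<and> aff_length n w = i}
      \<subseteq> gen_prod n ` {is. set is \<subseteq> {0..<n} \<and> length is = i}"
  proof
    fix w assume w: "w \<in> {w. affine_perm n w \<and> aff_length n w = i}"
    then obtain "is" where "int (length is) = window_inv n 0 w" "set is \<subseteq> {0..<n}" "w = gen_prod n is"
      using affine_perm_word[OF _ assms] by blast
    then show "w \<in> gen_prod n ` {is. set is \<subseteq> {0..<n} \<and> length is = i}"
      using w aff_length_eq_window_inv[OF _ assms, of w] by auto
  qed
  show "finite (gen_prod n ` {is. set is \<subseteq> {0..<n} \<and> length is = i})"
    by (intro finite_imageI finite_lists_length_eq) simp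
qed

section \<open>Pattern containment as difference constraints\<close>

lemma exists_int_between:
  fixes A B :: "int set"
  assumes "finite A" "finite B" "\<And>a b. a \<in> A \<Longrightarrow> b \<in> B \<Longrightarrow> a \<le> b"
  shows "\<exists>x. (\<forall>a\<in>A. a \<le> x) \<and> (\<forall>b\<in>B. x \<le> b)"
proof (cases "A = {}")
  case True
  show ?thesis
  proof (cases "B = {}")
    case False
    then show ?thesis using True assms by (intro exI[of _ "Min B"]) auto
  qed (use True in auto)
next
  case False
  then show ?thesis using assms by (intro exI[of _ "Max A"]) auto
qed

text \<open>Fourier--Motzkin elimination stays within difference constraints, whose bounds only
  ever get added; hence solvability over the integers is a finite conjunction of sign conditions.\<close>

lemma difference_constraints_elim:
  fixes E :: "('v \<times> 'v \<times> ('z \<Rightarrow> int)) set"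
  assumes "finite V" "finite E" "E \<subseteq> V \<times> V \<times> L"
    and add: "\<And>f g. f \<in> L \<Longrightarrow> g \<in> L \<Longrightarrow> (\<lambda>z. f z + g z) \<in> L"
  shows "\<exists>F. finite F \<and> F \<subseteq> L \<and>
    (\<forall>z. (\<exists>x::'v \<Rightarrow> int. \<forall>(a, b, f)\<in>E. x a - x b \<le> f z) \<longleftrightarrow> (\<forall>f\<in>F. 0 \<le> f z))"
  using assms(1-3)
proof (induction V arbitrary: E rule: finite_induct)
  case empty
  then show ?case by (intro exI[of _ "{}"]) auto
next
  case (insert v V)
  define E1 where "E1 = E \<inter> V \<times> V \<times> UNIV"
  \<comment> \<open>An edge into \<open>v\<close> bounds \<open>x v\<close> from below, an edge out
    of \<open>v\<close> bounds it from above, and in a loop the variable cancels. Each path of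
    length two through \<open>v\<close> is replaced by one edge whose bound is the sum.\<close>
  define In where "In = {(a, f). a \<in> V \<and> (a, v, f) \<in> E}"
  define Out where "Out = {(b, g). b \<in> V \<and> (v, b, g) \<in> E}"
  define Lo where "Lo = {f. (v, v, f) \<in> E}"
  define E2 where "E2 = (\<lambda>((a, f), (b, g)). (a, b, \<lambda>z. f z + g z)) ` (In \<times> Out)"
  have finIn: "finite In"
    by (rule finite_subset[of _ "(\<lambda>(a, b, f). (a, f)) ` E"]) (use insert.prems in \<open>force simp: In_def\<close>, use insert.prems in simp)
  have finOut: "finite Out"
    by (rule finite_subset[of _ "(\<lambda>(a, b, f). (b, f)) ` E"]) (use insert.prems in \<open>force simp: Out_def\<close>, use insert.prems in simp)
  have finLo: "finite Lo"
    by (rule finite_subset[of _ "(\<lambda>(a, b, f). f) ` E"]) (use insert.prems in \<open>force simp: Lo_def\<close>, use insert.prems in simp)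
  have sub: "E1 \<union> E2 \<subseteq> V \<times> V \<times> L"
    using insert.prems(2) by (auto simp: E1_def E2_def In_def Out_def intro!: add)
  have "finite (E1 \<union> E2)"
    using finIn finOut insert.prems(1) by (simp add: E1_def E2_def)
  then obtain F where F: "finite F" "F \<subseteq> L"
    "\<And>z. (\<exists>x::'v \<Rightarrow> int. \<forall>(a, b, f)\<in>E1 \<union> E2. x a - x b \<le> f z) \<longleftrightarrow> (\<forall>f\<in>F. 0 \<le> f z)"
    using insert.IH[OF _ sub] by blast
  have "(\<exists>x::'v \<Rightarrow> int. \<forall>(a, b, f)\<in>E. x a - x b \<le> f z) \<longleftrightarrow> (\<forall>f\<in>F \<union> Lo. 0 \<le> f z)" for z
  proof
    assume "\<exists>x::'v \<Rightarrow> int. \<forall>(a, b, f)\<in>E. x a - x b \<le> f z"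
    then obtain x :: "'v \<Rightarrow> int" where x: "\<And>a b f. (a, b, f) \<in> E \<Longrightarrow> x a - x b \<le> f z" by blast
    have "\<forall>(a, b, f)\<in>E1 \<union> E2. x a - x b \<le> f z"
    proof safe
      fix a b f assume "(a, b, f) \<in> E1"
      then show "x a - x b \<le> f z" using x by (auto simp: E1_def)
    next
      fix a b h assume "(a, b, h) \<in> E2"
      then obtain f g where "h = (\<lambda>z. f z + g z)" "(a, v, f) \<in> E" "(v, b, g) \<in> E"
        by (auto simp: E2_def In_def Out_def)
      then show "x a - x b \<le> h z" using x[of a v f] x[of v b g] by auto
    qed
    then have "\<forall>f\<in>F. 0 \<le> f z" using F(3)[of z] by blast
    moreover have "\<forall>f\<in>Lo. 0 \<le> f z" using x[of v v] by (auto simp: Lo_def)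
    ultimately show "\<forall>f\<in>F \<union> Lo. 0 \<le> f z" by blast
  next
    assume pos: "\<forall>f\<in>F \<union> Lo. 0 \<le> f z"
    then obtain x :: "'v \<Rightarrow> int" where x: "\<And>a b f. (a, b, f) \<in> E1 \<union> E2 \<Longrightarrow> x a - x b \<le> f z"
      using F(3)[of z] by blast
    \<comment> \<open>An integer value for \<open>v\<close> between all lower and all upper bounds;
      the composite edges in \<open>E2\<close> say exactly that these bounds are compatible.\<close>
    have "\<exists>t. (\<forall>s\<in>(\<lambda>(a, f). x a - f z) ` In. s \<le> t) \<and> (\<forall>s\<in>(\<lambda>(b, g). x b + g z) ` Out. t \<le> s)"
    proof (rule exists_int_between)
      fix s t assume "s \<in> (\<lambda>(a, f). x a - f z) ` In" "t \<in> (\<lambda>(b, g). x b + g z) ` Out"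
      then obtain a f b g where *: "(a, f) \<in> In" "(b, g) \<in> Out" "s = x a - f z" "t = x b + g z"
        by auto
      have "(a, b, \<lambda>z. f z + g z) \<in> E2" using *(1,2) unfolding E2_def by force
      then show "s \<le> t" using x[of a b "\<lambda>z. f z + g z"] * by auto
    qed (use finIn finOut in auto)
    then obtain t where t: "\<And>a f. (a, f) \<in> In \<Longrightarrow> x a - f z \<le> t"
      "\<And>b g. (b, g) \<in> Out \<Longrightarrow> t \<le> x b + g z" by fast
    have "(x(v := t)) a - (x(v := t)) b \<le> f z" if e: "(a, b, f) \<in> E" for a b f
    proof -
      have ab: "a \<in> insert v V" "b \<in> insert v V" using e insert.prems(2) by auto
      consider "a = v" "b = v" | "a = v" "b \<in> V" | "a \<in> V" "b = v" | "a \<in> V" "b \<in> V"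
        using ab by blast
      then show ?thesis
      proof cases
        case 1 then show ?thesis using pos e by (auto simp: Lo_def)
      next
        case 2 then show ?thesis using t(2)[of b f] e insert.hyps(2) by (auto simp: Out_def)
      next
        case 3 then show ?thesis using t(1)[of a f] e insert.hyps(2) by (auto simp: In_def)
      next
        case 4 then show ?thesis using x[of a b f] e insert.hyps(2) by (auto simp: E1_def)
      qed
    qed
    then show "\<exists>x::'v \<Rightarrow> int. \<forall>(a, b, f)\<in>E. x a - x b \<le> f z" by blast
  qed
  moreover have "Lo \<subseteq> L" using insert.prems(2) by (auto simp: Lo_def)
  ultimately show ?case using F(1,2) finLo by (intro exI[of _ "F \<union> Lo"]) auto
qed

lemma le_div_iff_mult_le:
  fixes x m n :: int
  assumes "n > 0"
  shows "x \<le> m div n \<longleftrightarrow> n * x \<le> m"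
proof
  assume "x \<le> m div n"
  then have "n * x \<le> n * (m div n)" using assms by simp
  also have "\<dots> \<le> m" using mult_div_mod_eq[of n m] pos_mod_sign[OF assms, of m] by linarith
  finally show "n * x \<le> m" .
next
  assume "n * x \<le> m"
  then have "(n * x) div n \<le> m div n" using assms by (intro zdiv_mono1)
  then show "x \<le> m div n" using assms by simp
qed

text \<open>Strictness costs the \<open>- 1\<close>; afterwards rounding down loses nothing because
  the unknown \<open>y - y'\<close> is an integer.\<close>

lemma affine_less_iff_div:
  fixes n :: int
  assumes "n > 0"
  shows "n * y + u < n * y' + u' \<longleftrightarrow> y - y' \<le> (u' - u - 1) div n"
  unfolding le_div_iff_mult_le[OF assms] right_diff_distrib by linarith

text \<open>Writing the positions as \<open>n * y a + \<chi> a\<close> with residues \<open>\<chi> a\<close> turns an occurrence of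
  a pattern into a system of difference constraints for \<open>y\<close>.\<close>

lemma contains_iff_colouring:
  assumes w: "periodic_bij n w" and n: "n > 0" and p: "distinct p"
  shows "contains w p \<longleftrightarrow> (\<exists>\<chi>\<in>PiE {..<length p} (\<lambda>_. {0..<int n}). \<exists>y :: nat \<Rightarrow> int.
      \<forall>a<length p. \<forall>b<length p.
        (a < b \<longrightarrow> y a - y b \<le> (\<chi> b - \<chi> a - 1) div int n) \<and>
        (p ! a < p ! b \<longrightarrow> y a - y b \<le> (w (\<chi> b) - w (\<chi> a) - 1) div int n))"
    (is "_ \<longleftrightarrow> ?R")
proof
  have n0: "int n > 0" using n by simp
  note win = periodic_window[of w n, OF periodic_bijD(2)[OF w]]
  assume "contains w p"
  then obtain ix :: "nat \<Rightarrow> int" where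
    ix: "\<And>a b. a < b \<Longrightarrow> b < length p \<Longrightarrow> ix a < ix b"
    "\<And>a b. a < length p \<Longrightarrow> b < length p \<Longrightarrow> (w (ix a) < w (ix b) \<longleftrightarrow> p ! a < p ! b)"
    unfolding contains_def by blast
  define \<chi> where "\<chi> = restrict (\<lambda>a. ix a mod int n) {..<length p}"
  define y where "y = (\<lambda>a. ix a div int n)"
  have "\<chi> \<in> PiE {..<length p} (\<lambda>_. {0..<int n})" using n by (auto simp: \<chi>_def)
  moreover have "y a - y b \<le> (\<chi> b - \<chi> a - 1) div int n"
    if "a < length p" "b < length p" "a < b" for a b
    using ix(1)[OF that(3,2)] that
      affine_less_iff_div[OF n0, of "y a" "\<chi> a" "y b" "\<chi> b"]
    by (simp add: y_def \<chi>_def)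
  moreover have "y a - y b \<le> (w (\<chi> b) - w (\<chi> a) - 1) div int n"
    if "a < length p" "b < length p" "p ! a < p ! b" for a b
    using ix(2)[OF that(1,2)] that win[of "ix a"] win[of "ix b"]
      affine_less_iff_div[OF n0, of "y a" "w (\<chi> a)" "y b" "w (\<chi> b)"]
    by (simp add: y_def \<chi>_def)
  ultimately show ?R by blast
next
  have n0: "int n > 0" using n by simp
  note shift = periodic_shift[of w n, OF periodic_bijD(2)[OF w]]
  assume ?R
  then obtain \<chi> y where
    y1: "\<And>a b. a < length p \<Longrightarrow> b < length p \<Longrightarrow> a < b \<Longrightarrow>
        y a - y b \<le> (\<chi> b - \<chi> a - 1) div int n" and
    y2: "\<And>a b. a < length p \<Longrightarrow> b < length p \<Longrightarrow> p ! a < p ! b \<Longrightarrow>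
        y a - y b \<le> (w (\<chi> b) - w (\<chi> a) - 1) div int n"
    by blast
  define ix where "ix = (\<lambda>a. \<chi> a + int n * y a)"
  have lt: "w (ix a) < w (ix b)" if "a < length p" "b < length p" "p ! a < p ! b" for a b
    using y2[OF that] affine_less_iff_div[OF n0, of "y a" "w (\<chi> a)" "y b" "w (\<chi> b)"]
    by (simp add: ix_def shift add.commute)
  have "ix a < ix b" if "a < b" "b < length p" for a b
    using y1[of a b] that affine_less_iff_div[OF n0, of "y a" "\<chi> a" "y b" "\<chi> b"]
    by (simp add: ix_def add.commute)
  \<comment> \<open>One implication gives the equivalence, because distinct entries of
    \<open>p\<close> leave only \<open>a = b\<close> or one of the two strict orders.\<close>
  moreover have "w (ix a) < w (ix b) \<longleftrightarrow> p ! a < p ! b" if "a < length p" "b < length p" for a b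
    using lt[OF that] lt[OF that(2,1)] p that
    by (metis less_asym less_irrefl nat_neq_iff nth_eq_iff_index_eq)
  ultimately show "contains w p" unfolding contains_def by blast
qed

text \<open>Each of the finitely many colourings of the pattern positions by residues leaves a
  difference system, solvable iff finitely many forms are nonnegative. The class \<open>L\<close> is
  kept abstract to serve both affine forms along a ray and affine forms on the plane of quotient
  vectors for \<open>n = 3\<close>.\<close>

lemma contains_family:
  fixes W :: "'z \<Rightarrow> int \<Rightarrow> int"
  assumes n: "n > 0" and p: "distinct p" and W: "\<And>z. periodic_bij n (W z)"
    and add: "\<And>f g. f \<in> L \<Longrightarrow> g \<in> L \<Longrightarrow> (\<lambda>z. f z + g z) \<in> L"
    and const: "\<And>k. (\<lambda>_. k) \<in> L"
    and gap: "\<And>c d. c \<in> {0..<int n} \<Longrightarrow> d \<in> {0..<int n} \<Longrightarrow>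
      (\<lambda>z. (W z d - W z c - 1) div int n) \<in> L"
  shows "\<exists>\<F>. finite \<F> \<and> (\<forall>F\<in>\<F>. finite F \<and> F \<subseteq> L) \<and>
    (\<forall>z. contains (W z) p \<longleftrightarrow> (\<exists>F\<in>\<F>. \<forall>f\<in>F. 0 \<le> f z))"
proof -
  let ?k = "length p"
  let ?P = "PiE {..<?k} (\<lambda>_. {0..<int n})"
  let ?S = "\<lambda>\<chi> z. \<exists>y :: nat \<Rightarrow> int. \<forall>a<?k. \<forall>b<?k.
        (a < b \<longrightarrow> y a - y b \<le> (\<chi> b - \<chi> a - 1) div int n) \<and>
        (p ! a < p ! b \<longrightarrow> y a - y b \<le> (W z (\<chi> b) - W z (\<chi> a) - 1) div int n)"
  have "\<forall>\<chi>\<in>?P. \<exists>F. finite F \<and> F \<subseteq> L \<and> (\<forall>z. ?S \<chi> z \<longleftrightarrow> (\<forall>f\<in>F. 0 \<le> f z))"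
  proof
    fix \<chi> assume \<chi>: "\<chi> \<in> ?P"
    define V where "V = {..<?k}"
    define E1 :: "(nat \<times> nat \<times> ('z \<Rightarrow> int)) set" where
      "E1 = (\<lambda>(a, b). (a, b, \<lambda>z. (\<chi> b - \<chi> a - 1) div int n)) ` {(a, b) \<in> V \<times> V. a < b}"
    define E2 where
      "E2 = (\<lambda>(a, b). (a, b, \<lambda>z. (W z (\<chi> b) - W z (\<chi> a) - 1) div int n)) `
         {(a, b) \<in> V \<times> V. p ! a < p ! b}"
    have V: "finite V" by (simp add: V_def)
    have fin: "finite {(a, b) \<in> V \<times> V. Q a b}" for Q :: "nat \<Rightarrow> nat \<Rightarrow> bool"
      by (rule finite_subset[of _ "V \<times> V"]) (use V in auto)
    have E: "finite (E1 \<union> E2)"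
      unfolding E1_def E2_def by (intro finite_UnI finite_imageI fin)
    have "\<chi> a \<in> {0..<int n}" if "a \<in> V" for a using \<chi> that unfolding V_def by (rule PiE_mem)
    then have sub: "E1 \<union> E2 \<subseteq> V \<times> V \<times> L"
      by (auto simp: E1_def E2_def intro!: const gap simp del: atLeastLessThan_iff)
    obtain F where F: "finite F" "F \<subseteq> L"
      "\<forall>z. (\<exists>x::nat \<Rightarrow> int. \<forall>(a, b, f)\<in>E1 \<union> E2. x a - x b \<le> f z) \<longleftrightarrow> (\<forall>f\<in>F. 0 \<le> f z)"
      using difference_constraints_elim[OF V E sub add] by blast
    have "?S \<chi> z \<longleftrightarrow> (\<exists>x::nat \<Rightarrow> int. \<forall>(a, b, f)\<in>E1 \<union> E2. x a - x b \<le> f z)" for z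
    proof (rule ex_cong1)
      fix y :: "nat \<Rightarrow> int"
      have "(\<forall>(a, b, f)\<in>E1. y a - y b \<le> f z) \<longleftrightarrow>
          (\<forall>a<?k. \<forall>b<?k. a < b \<longrightarrow> y a - y b \<le> (\<chi> b - \<chi> a - 1) div int n)"
        unfolding E1_def V_def ball_simps(9) by (simp add: split_def) blast
      moreover have "(\<forall>(a, b, f)\<in>E2. y a - y b \<le> f z) \<longleftrightarrow>
          (\<forall>a<?k. \<forall>b<?k. p ! a < p ! b \<longrightarrow>
             y a - y b \<le> (W z (\<chi> b) - W z (\<chi> a) - 1) div int n)"
        unfolding E2_def V_def ball_simps(9) by (simp add: split_def) blast
      ultimately show "(\<forall>a<?k. \<forall>b<?k.
          (a < b \<longrightarrow> y a - y b \<le> (\<chi> b - \<chi> a - 1) div int n) \<and>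
          (p ! a < p ! b \<longrightarrow> y a - y b \<le> (W z (\<chi> b) - W z (\<chi> a) - 1) div int n)) \<longleftrightarrow>
          (\<forall>(a, b, f)\<in>E1 \<union> E2. y a - y b \<le> f z)"
        unfolding ball_Un by blast
    qed
    then show "\<exists>F. finite F \<and> F \<subseteq> L \<and> (\<forall>z. ?S \<chi> z \<longleftrightarrow> (\<forall>f\<in>F. 0 \<le> f z))"
      using F by (intro exI[of _ F]) simp
  qed
  from bchoice[OF this] obtain G where G: "\<forall>\<chi>\<in>?P.
      finite (G \<chi>) \<and> G \<chi> \<subseteq> L \<and> (\<forall>z. ?S \<chi> z \<longleftrightarrow> (\<forall>f\<in>G \<chi>. 0 \<le> f z))" ..
  have "contains (W z) p \<longleftrightarrow> (\<exists>F\<in>G ` ?P. \<forall>f\<in>F. 0 \<le> f z)" for z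
  proof -
    have "contains (W z) p \<longleftrightarrow> (\<exists>\<chi>\<in>?P. ?S \<chi> z)" by (rule contains_iff_colouring[OF W n p])
    also have "\<dots> \<longleftrightarrow> (\<exists>\<chi>\<in>?P. \<forall>f\<in>G \<chi>. 0 \<le> f z)"
      by (rule bex_cong[OF refl]) (use G in simp)
    finally show ?thesis by simp
  qed
  moreover have "finite (G ` ?P)" by (intro finite_imageI finite_PiE) auto
  moreover have "\<forall>F\<in>G ` ?P. finite F \<and> F \<subseteq> L" using G by simp
  ultimately show ?thesis by (intro exI[of _ "G ` ?P"]) simp
qed

section \<open>Rays of periodic bijections: eventual containment and eventual length\<close>

text \<open>The residues of the values stay fixed, and the vector of quotients modulo
  \<open>n\<close> moves by \<open>s\<close> times the direction \<open>v\<close>.\<close>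

definition ray :: "nat \<Rightarrow> (int \<Rightarrow> int) \<Rightarrow> (int \<Rightarrow> int) \<Rightarrow> int \<Rightarrow> int \<Rightarrow> int" where
  "ray n w v s x = w x + int n * (s * v (x mod int n))"

lemma periodic_bij_ray:
  assumes w: "periodic_bij n w" and n: "n > 0"
  shows "periodic_bij n (ray n w v s)"
proof (rule periodic_bijI[OF n])
  show "ray n w v s (i + int n) = ray n w v s i + int n" for i
    using periodic_bijD(2)[OF w, of i] by (simp add: ray_def)
  fix c d assume cd: "0 \<le> c" "c < int n" "0 \<le> d" "d < int n"
    and "ray n w v s c mod int n = ray n w v s d mod int n"
  then have "w c mod int n = w d mod int n" by (simp add: ray_def)
  then show "c = d" using periodic_bij_inj_mod[OF w n, of c d] cd by simp
qed

lemma affine_perm_ray: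
  assumes w: "affine_perm n w" and n: "n > 0" and v: "(\<Sum>i\<in>{0..<int n}. v i) = 0"
  shows "affine_perm n (ray n w v s)"
proof -
  have "(\<Sum>i\<in>{0..<int n}. ray n w v s i) = (\<Sum>i\<in>{0..<int n}. w i + int n * s * v i)"
    by (intro sum.cong refl) (simp add: ray_def)
  also have "\<dots> = (\<Sum>i\<in>{0..<int n}. w i)"
    by (simp add: sum.distrib v flip: sum_distrib_left)
  finally show ?thesis
    using w periodic_bij_ray[OF affine_perm_periodic_bij[OF w] n]
    by (simp add: affine_perm_iff)
qed

text \<open>The displacement is a multiple of \<open>n\<close>, so the floor is exactly affine in
  \<open>s\<close>. The case \<open>k = 1\<close> serves the containment constraints,
  \<open>k = 0\<close> the length.\<close>

lemma ray_gap:
  assumes "c \<in> {0..<int n}" "d \<in> {0..<int n}"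
  shows "(ray n w v s d - ray n w v s c - k) div int n = (v d - v c) * s + (w d - w c - k) div int n"
proof -
  have "ray n w v s d - ray n w v s c - k = (w d - w c - k) + int n * ((v d - v c) * s)"
    using assms by (simp add: ray_def algebra_simps)
  then show ?thesis using assms by (simp only: div_mult_self2 add.commute) auto
qed

lemma affine_eventually_sign:
  "(\<forall>\<^sub>F s::nat in sequentially. 0 \<le> \<alpha> * int s + \<beta>) \<or> (\<forall>\<^sub>F s::nat in sequentially. \<alpha> * int s + \<beta> < 0)"
proof -
  consider "\<alpha> > 0" | "\<alpha> = 0" | "\<alpha> < 0" by linarith
  then show ?thesis
  proof cases
    case 1
    have "0 \<le> \<alpha> * int s + \<beta>" if "nat \<bar>\<beta>\<bar> \<le> s" for s
    proof -
      have "1 * \<bar>\<beta>\<bar> \<le> \<alpha> * int s" by (rule mult_mono) (use 1 that in auto)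
      then show ?thesis by linarith
    qed
    then show ?thesis using eventually_sequentially by blast
  next
    case 2 then show ?thesis by (cases "0 \<le> \<beta>") auto
  next
    case 3
    have "\<alpha> * int s + \<beta> < 0" if "nat \<bar>\<beta>\<bar> + 1 \<le> s" for s
    proof -
      have "1 * (\<bar>\<beta>\<bar> + 1) \<le> (- \<alpha>) * int s" by (rule mult_mono) (use 3 that in auto)
      then show ?thesis by simp
    qed
    then show ?thesis using eventually_sequentially by blast
  qed
qed

text \<open>An affine form in \<open>s\<close> has an eventually constant sign. Containment along
  the ray is a finite disjunction of finite conjunctions of such sign conditions, so its truth value
  settles as well.\<close>

lemma contains_ray_eventually:
  assumes w: "periodic_bij n w" and n: "n > 0" and p: "distinct p"
  shows "(\<forall>\<^sub>F s::nat in sequentially. contains (ray n w v (int s)) p) \<or>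
    (\<forall>\<^sub>F s::nat in sequentially. \<not> contains (ray n w v (int s)) p)"
proof -
  define L where "L = {f :: nat \<Rightarrow> int. \<exists>\<alpha> \<beta>. f = (\<lambda>s. \<alpha> * int s + \<beta>)}"
  have "(\<lambda>z. f z + g z) \<in> L" if fg: "f \<in> L" "g \<in> L" for f g
  proof -
    obtain a b a' b' where "f = (\<lambda>s. a * int s + b)" "g = (\<lambda>s. a' * int s + b')"
      using fg unfolding L_def by blast
    then show ?thesis unfolding L_def
      by (intro CollectI exI[of _ "a + a'"] exI[of _ "b + b'"]) (simp add: fun_eq_iff algebra_simps)
  qed
  note add = this
  have const: "(\<lambda>_. k) \<in> L" for k
    unfolding L_def by (intro CollectI exI[of _ 0] exI[of _ k]) simp
  have gap: "(\<lambda>s. (ray n w v (int s) d - ray n w v (int s) c - 1) div int n) \<in> L"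
    if "c \<in> {0..<int n}" "d \<in> {0..<int n}" for c d
    unfolding L_def ray_gap[OF that] by blast
  obtain \<F> where \<F>: "finite \<F>" "\<And>F. F \<in> \<F> \<Longrightarrow> finite F \<and> F \<subseteq> L"
    "\<And>s. contains (ray n w v (int s)) p \<longleftrightarrow> (\<exists>F\<in>\<F>. \<forall>f\<in>F. 0 \<le> f s)"
    using contains_family[OF n p periodic_bij_ray[OF w n] add const gap] by blast
  have sgn: "(\<forall>\<^sub>F s in sequentially. 0 \<le> f s) \<or> (\<forall>\<^sub>F s in sequentially. f s < 0)" if "f \<in> L" for f
    using that affine_eventually_sign by (auto simp: L_def)
  show ?thesis
  proof (cases "\<exists>F\<in>\<F>. \<forall>f\<in>F. \<forall>\<^sub>F s in sequentially. 0 \<le> f s")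
    case True
    then obtain F where F: "F \<in> \<F>" "\<forall>f\<in>F. \<forall>\<^sub>F s in sequentially. 0 \<le> f s" by blast
    then have "\<forall>\<^sub>F s in sequentially. \<forall>f\<in>F. 0 \<le> f s"
      using \<F>(2) by (intro eventually_ball_finite) auto
    then have "\<forall>\<^sub>F s in sequentially. contains (ray n w v (int s)) p"
      by eventually_elim (use F(1) \<F>(3) in blast)
    then show ?thesis ..
  next
    case False
    have "\<forall>F\<in>\<F>. \<forall>\<^sub>F s in sequentially. \<exists>f\<in>F. f s < 0"
    proof
      fix F assume "F \<in> \<F>"
      then obtain f where f: "f \<in> F" "\<not> (\<forall>\<^sub>F s in sequentially. 0 \<le> f s)" using False by blast
      then have "\<forall>\<^sub>F s in sequentially. f s < 0" using sgn \<F>(2)[OF \<open>F \<in> \<F>\<close>] by blast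
      then show "\<forall>\<^sub>F s in sequentially. \<exists>f\<in>F. f s < 0"
        by eventually_elim (use f(1) in blast)
    qed
    then have "\<forall>\<^sub>F s in sequentially. \<forall>F\<in>\<F>. \<exists>f\<in>F. f s < 0"
      using \<F>(1) by (intro eventually_ball_finite) auto
    then have "\<forall>\<^sub>F s in sequentially. \<not> contains (ray n w v (int s)) p"
      by eventually_elim (use \<F>(3) in \<open>force simp: not_le[symmetric]\<close>)
    then show ?thesis ..
  qed
qed

lemma abs_affine_eventually:
  "\<exists>b. \<forall>\<^sub>F s::nat in sequentially. \<bar>\<alpha> * int s + \<beta>\<bar> = \<bar>\<alpha>\<bar> * int s + b"
proof (cases "\<alpha> = 0")
  case False
  consider "\<forall>\<^sub>F s::nat in sequentially. 0 \<le> \<alpha> * int s + \<beta>" "\<alpha> > 0"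
    | "\<forall>\<^sub>F s::nat in sequentially. \<alpha> * int s + \<beta> < 0" "\<alpha> < 0"
  proof -
    have "\<forall>\<^sub>F s::nat in sequentially. \<bar>\<beta>\<bar> + 1 \<le> int s"
      using eventually_ge_at_top[of "nat (\<bar>\<beta>\<bar> + 1)"] by eventually_elim simp
    then have ev: "\<forall>\<^sub>F s::nat in sequentially. \<bar>\<beta>\<bar> + 1 \<le> \<bar>\<alpha>\<bar> * int s"
    proof eventually_elim
      case (elim s)
      then show ?case using mult_mono[of 1 "\<bar>\<alpha>\<bar>" "\<bar>\<beta>\<bar> + 1" "int s"] False by auto
    qed
    show ?thesis
    proof (cases "\<alpha> > 0")
      case True
      from ev have "\<forall>\<^sub>F s::nat in sequentially. 0 \<le> \<alpha> * int s + \<beta>"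
        by eventually_elim (use True in auto)
      then show ?thesis using that(1) True by blast
    next
      case F: False
      from ev have "\<forall>\<^sub>F s::nat in sequentially. \<alpha> * int s + \<beta> < 0"
        by eventually_elim (use F in auto)
      then show ?thesis using that(2) F False by auto
    qed
  qed
  then show ?thesis
  proof cases
    case 1
    from 1(1) have "\<forall>\<^sub>F s::nat in sequentially. \<bar>\<alpha> * int s + \<beta>\<bar> = \<bar>\<alpha>\<bar> * int s + \<beta>"
      by eventually_elim (use 1(2) in auto)
    then show ?thesis by blast
  next
    case 2
    from 2(1) have "\<forall>\<^sub>F s::nat in sequentially. \<bar>\<alpha> * int s + \<beta>\<bar> = \<bar>\<alpha>\<bar> * int s + - \<beta>"
      by eventually_elim (use 2(2) in auto)
    then show ?thesis by blast
  qed
qed auto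

lemma sum_affine_eventually:
  fixes f :: "'i \<Rightarrow> nat \<Rightarrow> int"
  assumes "finite I" "\<And>i. i \<in> I \<Longrightarrow> \<exists>b. \<forall>\<^sub>F s in sequentially. f i s = a i * int s + b"
  shows "\<exists>b. \<forall>\<^sub>F s in sequentially. (\<Sum>i\<in>I. f i s) = (\<Sum>i\<in>I. a i) * int s + b"
proof -
  obtain b where b: "\<And>i. i \<in> I \<Longrightarrow> \<forall>\<^sub>F s in sequentially. f i s = a i * int s + b i"
    using assms(2) by metis
  then have "\<forall>\<^sub>F s in sequentially. \<forall>i\<in>I. f i s = a i * int s + b i"
    using assms(1) by (intro eventually_ball_finite) auto
  then have "\<forall>\<^sub>F s in sequentially. (\<Sum>i\<in>I. f i s) = (\<Sum>i\<in>I. a i) * int s + (\<Sum>i\<in>I. b i)"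
    by eventually_elim (simp add: sum.distrib sum_distrib_right)
  then show ?thesis by blast
qed

text \<open>The slope is the sum of all \<open>\<bar>v j - v i\<bar>\<close>. It vanishes only for
  constant \<open>v\<close>, and a constant vector with sum 0 is zero.\<close>

lemma window_inv_ray_eventually:
  assumes n: "n > 0" and v: "(\<Sum>i\<in>{0..<int n}. v i) = 0" "\<exists>i\<in>{0..<int n}. v i \<noteq> 0"
  shows "\<exists>a b. a > 0 \<and> (\<forall>\<^sub>F s::nat in sequentially. window_inv n 0 (ray n w v (int s)) = a * int s + b)"
proof -
  let ?I = "{0..<int n}"
  let ?P = "Sigma ?I (\<lambda>i. {i<..<int n})"
  let ?f = "\<lambda>(i, j) s. \<bar>(ray n w v (int s) j - ray n w v (int s) i) div int n\<bar>"
  let ?a = "\<lambda>(i, j). \<bar>v j - v i\<bar>"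
  have eq: "window_inv n 0 (ray n w v (int s)) = (\<Sum>q\<in>?P. ?f q s)" for s
    unfolding window_inv_def by (simp add: sum.Sigma split_def)
  have fin: "finite ?P" by simp
  have "\<exists>b. \<forall>\<^sub>F s in sequentially. ?f q s = ?a q * int s + b" if qP: "q \<in> ?P" for q
  proof -
    obtain i j where q: "q = (i, j)" "i \<in> ?I" "j \<in> ?I" using qP by auto
    have "?f q s = \<bar>(v j - v i) * int s + (w j - w i) div int n\<bar>" for s
      using ray_gap[OF q(2,3), of w v "int s" 0] q(1) by simp
    then show ?thesis using abs_affine_eventually[of "v j - v i" "(w j - w i) div int n"] q(1) by simp
  qed
  from sum_affine_eventually[of ?P ?f ?a, OF fin this] obtain b where
    b: "\<forall>\<^sub>F s in sequentially. (\<Sum>q\<in>?P. ?f q s) = (\<Sum>q\<in>?P. ?a q) * int s + b"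
    by auto
  have "(\<Sum>q\<in>?P. ?a q) \<noteq> 0"
  proof
    assume "(\<Sum>q\<in>?P. ?a q) = 0"
    then have "\<forall>q\<in>?P. ?a q = 0" using fin by (subst (asm) sum_nonneg_eq_0_iff) auto
    then have "v j = v i" if "i \<in> ?I" "j \<in> ?I" "i < j" for i j using that by fastforce
    then have c: "v i = v 0" if "i \<in> ?I" for i using that n by (cases "i = 0") auto
    then have "(\<Sum>i\<in>?I. v i) = (\<Sum>i\<in>?I. v 0)" by (intro sum.cong refl) blast
    then have "v 0 = 0" using v(1) n by simp
    then show False using c v(2) by simp
  qed
  moreover have "(\<Sum>q\<in>?P. ?a q) \<ge> 0" by (intro sum_nonneg) auto
  ultimately show ?thesis using b unfolding eq by (intro exI[of _ "\<Sum>q\<in>?P. ?a q"] exI[of _ b]) auto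
qed

section \<open>Counting along rays\<close>

lemma eventually_nat_greater_finite:
  fixes f :: "'i \<Rightarrow> int"
  assumes "finite I"
  shows "\<forall>\<^sub>F i::nat in sequentially. \<forall>x\<in>I. f x < int i"
proof (rule eventually_ball_finite[OF assms], rule ballI)
  fix x
  show "\<forall>\<^sub>F i::nat in sequentially. f x < int i"
    using eventually_ge_at_top[of "nat (f x) + 1"] by eventually_elim linarith
qed

text \<open>Different rays may pass through the same permutation, so points and not rays are
  counted. To compare two lengths it is enough that the same rays coincide at both.\<close>

lemma card_image_eq_of_same_fibres:
  assumes "\<And>x y. x \<in> J \<Longrightarrow> y \<in> J \<Longrightarrow> f x = f y \<longleftrightarrow> g x = g y"
  shows "card (f ` J) = card (g ` J)"
proof -
  have "bij_betw (\<lambda>u. g (SOME x. x \<in> J \<and> f x = u)) (f ` J) (g ` J)"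
  proof (rule bij_betwI')
    have some: "(SOME z. z \<in> J \<and> f z = f x) \<in> J \<and> f (SOME z. z \<in> J \<and> f z = f x) = f x"
      if "x \<in> J" for x
      using someI[of "\<lambda>z. z \<in> J \<and> f z = f x" x] that by blast
    have G: "g (SOME z. z \<in> J \<and> f z = f x) = g x" if "x \<in> J" for x
      using some[OF that] assms that by blast
    show "(g (SOME z. z \<in> J \<and> f z = u) = g (SOME z. z \<in> J \<and> f z = u')) = (u = u')"
      if "u \<in> f ` J" "u' \<in> f ` J" for u u'
      using that G assms by auto
    show "g (SOME z. z \<in> J \<and> f z = u) \<in> g ` J" if "u \<in> f ` J" for u
      using that G by auto
    show "\<exists>u\<in>f ` J. t = g (SOME z. z \<in> J \<and> f z = u)" if "t \<in> g ` J" for t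
      using that G by auto
  qed
  then show ?thesis by (rule bij_betw_same_card)
qed

text \<open>Two rays parametrised by length that are not parallel meet only finitely often.\<close>

lemma ray_eq_imp_parallel:
  assumes n: "n > 0" and x: "x \<in> {0..<int n}" and eq: "ray n w v t = ray n w' v' t'"
    and t: "a * t + b = i" "a' * t' + b' = i"
    and i: "\<bar>a * a' * (w' x - w x) + int n * (a' * b * v x - a * b' * v' x)\<bar> < i"
  shows "a' * v x = a * v' x"
proof (rule ccontr)
  assume ne: "a' * v x \<noteq> a * v' x"
  have "w x + int n * (t * v x) = w' x + int n * (t' * v' x)"
    using fun_cong[OF eq, of x] x by (simp add: ray_def)
  \<comment> \<open>The factor \<open>a * a'\<close> lets \<open>a * t\<close> and
    \<open>a' * t'\<close> be replaced by \<open>i - b\<close> and \<open>i - b'\<close>. What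
    results is linear in \<open>i\<close>; if its leading coefficient, a nonzero integer, did not
    vanish, \<open>i\<close> could not exceed the constant term.\<close>
  then have "a * a' * (w x + int n * (t * v x)) = a * a' * (w' x + int n * (t' * v' x))" by simp
  then have "int n * (a' * (a * t) * v x - a * (a' * t') * v' x) = a * a' * (w' x - w x)"
    by (simp add: algebra_simps)
  moreover have "a * t = i - b" "a' * t' = i - b'" using t by auto
  ultimately have "int n * (a' * (i - b) * v x - a * (i - b') * v' x) = a * a' * (w' x - w x)"
    by simp
  then have e: "(int n * (a' * v x - a * v' x)) * i
      = a * a' * (w' x - w x) + int n * (a' * b * v x - a * b' * v' x)"
    by (simp add: algebra_simps)
  have "int n * (a' * v x - a * v' x) \<noteq> 0" using ne n by simp
  then have "1 \<le> \<bar>int n * (a' * v x - a * v' x)\<bar>" by linarith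
  moreover have i0: "0 < i" using i by linarith
  ultimately have "1 * i \<le> \<bar>int n * (a' * v x - a * v' x)\<bar> * i" by (intro mult_right_mono) auto
  also have "\<dots> = \<bar>(int n * (a' * v x - a * v' x)) * i\<bar>" using i0 by (simp add: abs_mult)
  also have "\<dots> < i" unfolding e using i .
  finally show False by simp
qed

lemma ray_add: "ray n w v (s + t) x = ray n w v s x + int n * (t * v (x mod int n))"
  by (simp add: ray_def algebra_simps)

text \<open>For large \<open>i\<close> the avoiders of length \<open>i\<close> are the points where
  eventually avoiding rays reach length \<open>i\<close>. A period \<open>N\<close> divisible by all
  slopes preserves which rays reach the length at an integer parameter, and also which of them
  coincide there, since rays that meet far out are parallel.\<close>

lemma periodic_for_if_covered_by_rays:
  assumes n: "n \<ge> 2" and p: "distinct p" and R: "finite R"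
    and Rw: "\<And>w v. (w, v) \<in> R \<Longrightarrow> affine_perm n w"
    and Rv: "\<And>w v. (w, v) \<in> R \<Longrightarrow> (\<Sum>i\<in>{0..<int n}. v i) = 0 \<and> (\<exists>i\<in>{0..<int n}. v i \<noteq> 0)"
    and cover: "\<And>w. affine_perm n w \<Longrightarrow> avoids w p \<Longrightarrow> \<exists>(w0, v)\<in>R. \<exists>s::nat. w = ray n w0 v (int s)"
  shows "periodic_for p n"
proof -
  have n0: "n > 0" using n by simp
  define \<rho> where "\<rho> = (\<lambda>(w, v). ray n w v)"
  have aff: "affine_perm n (\<rho> r s)" if "r \<in> R" for r s
  proof -
    obtain w v where "r = (w, v)" by fastforce
    then show ?thesis using affine_perm_ray[OF Rw n0] Rv[of w v] that by (simp add: \<rho>_def)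
  qed
  have "\<forall>r\<in>R. \<exists>ab. fst ab > 0 \<and>
      (\<forall>\<^sub>F s::nat in sequentially. window_inv n 0 (\<rho> r (int s)) = fst ab * int s + snd ab)"
  proof
    fix r assume "r \<in> R"
    then show "\<exists>ab. fst ab > 0 \<and>
      (\<forall>\<^sub>F s::nat in sequentially. window_inv n 0 (\<rho> r (int s)) = fst ab * int s + snd ab)"
      using window_inv_ray_eventually[OF n0, of "snd r" "fst r"] Rv[of "fst r" "snd r"]
      by (auto simp: \<rho>_def split_def)
  qed
  from bchoice[OF this] obtain ab where ab: "\<forall>r\<in>R. fst (ab r) > 0 \<and>
      (\<forall>\<^sub>F s::nat in sequentially. window_inv n 0 (\<rho> r (int s)) = fst (ab r) * int s + snd (ab r))" ..
  define a where "a r = fst (ab r)" for r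
  define b where "b r = snd (ab r)" for r
  have a: "a r > 0" if "r \<in> R" for r using ab that by (simp add: a_def)
  define good where "good r \<longleftrightarrow> (\<forall>\<^sub>F s::nat in sequentially. avoids (\<rho> r (int s)) p)" for r
  have "\<forall>\<^sub>F s::nat in sequentially. \<forall>r\<in>R.
      window_inv n 0 (\<rho> r (int s)) = a r * int s + b r \<and> (avoids (\<rho> r (int s)) p \<longleftrightarrow> good r)"
  proof (rule eventually_ball_finite[OF R], rule ballI)
    fix r assume r: "r \<in> R"
    have "\<forall>\<^sub>F s::nat in sequentially. avoids (\<rho> r (int s)) p \<longleftrightarrow> good r"
    proof (cases "good r")
      case True
      then show ?thesis by (simp add: good_def)
    next
      case False
      have "periodic_bij n (fst r)"
        using Rw[of "fst r" "snd r"] r by (simp add: affine_perm_periodic_bij)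
      from contains_ray_eventually[OF this n0 p, of "snd r"] False
      show ?thesis by (auto simp: good_def avoids_def \<rho>_def split_def)
    qed
    moreover have "\<forall>\<^sub>F s::nat in sequentially. window_inv n 0 (\<rho> r (int s)) = a r * int s + b r"
      using ab r by (simp add: a_def b_def)
    ultimately show "\<forall>\<^sub>F s::nat in sequentially.
        window_inv n 0 (\<rho> r (int s)) = a r * int s + b r \<and> (avoids (\<rho> r (int s)) p \<longleftrightarrow> good r)"
      by eventually_elim simp
  qed
  \<comment> \<open>From parameter \<open>S\<close> on, every ray obeys its length formula and its
    avoidance status is settled.\<close>
  then obtain S where S: "\<And>r s. r \<in> R \<Longrightarrow> S \<le> s \<Longrightarrow>
      window_inv n 0 (\<rho> r (int s)) = a r * int s + b r \<and> (avoids (\<rho> r (int s)) p \<longleftrightarrow> good r)"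
    unfolding eventually_sequentially by blast
  have "\<forall>\<^sub>F i::nat in sequentially. \<forall>(r, s)\<in>R \<times> {..<S}. window_inv n 0 (\<rho> r (int s)) < int i"
    using eventually_nat_greater_finite[of "R \<times> {..<S}" "\<lambda>(r, s). window_inv n 0 (\<rho> r (int s))"] R
    by (auto simp: split_def)
  moreover have "\<forall>\<^sub>F i::nat in sequentially. \<forall>r\<in>R. a r * int S + b r < int i"
    using eventually_nat_greater_finite[OF R, of "\<lambda>r. a r * int S + b r"] .
  moreover have "\<forall>\<^sub>F i::nat in sequentially. \<forall>(r, r', x)\<in>R \<times> R \<times> {0..<int n}.
     \<bar>a r * a r' * (fst r' x - fst r x)
        + int n * (a r' * b r * snd r x - a r * b r' * snd r' x)\<bar> < int i"
    using eventually_nat_greater_finite[of "R \<times> R \<times> {0..<int n}" "\<lambda>(r, r', x).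
     \<bar>a r * a r' * (fst r' x - fst r x)
        + int n * (a r' * b r * snd r x - a r * b r' * snd r' x)\<bar>"] R
    by (auto simp: split_def)
  ultimately have "\<forall>\<^sub>F i::nat in sequentially.
     (\<forall>(r, s)\<in>R \<times> {..<S}. window_inv n 0 (\<rho> r (int s)) < int i) \<and>
     (\<forall>r\<in>R. a r * int S + b r < int i) \<and>
     (\<forall>(r, r', x)\<in>R \<times> R \<times> {0..<int n}.
     \<bar>a r * a r' * (fst r' x - fst r x)
        + int n * (a r' * b r * snd r x - a r * b r' * snd r' x)\<bar> < int i)"
    by eventually_elim simp
  \<comment> \<open>Three thresholds for the length: \<open>I1\<close> excludes the irregular points
    with parameter below \<open>S\<close>, \<open>I2\<close> forces the parameter computed from the
    length formula above \<open>S\<close>, and \<open>I3\<close> makes coinciding rays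
    parallel.\<close>
  then obtain I where
    I1: "\<And>i r s. I \<le> i \<Longrightarrow> r \<in> R \<Longrightarrow> s < S \<Longrightarrow> window_inv n 0 (\<rho> r (int s)) < int i" and
    I2: "\<And>i r. I \<le> i \<Longrightarrow> r \<in> R \<Longrightarrow> a r * int S + b r < int i" and
    I3: "\<And>i r r' x. I \<le> i \<Longrightarrow> r \<in> R \<Longrightarrow> r' \<in> R \<Longrightarrow> x \<in> {0..<int n} \<Longrightarrow>
     \<bar>a r * a r' * (fst r' x - fst r x)
        + int n * (a r' * b r * snd r x - a r * b r' * snd r' x)\<bar> < int i"
    unfolding eventually_sequentially by fast
  \<comment> \<open>Any common multiple of the slopes would serve: adding it to the length keeps
    each divisibility condition in \<open>J\<close> and advances each ray by the integer
    \<open>N div a r\<close>.\<close>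
  define N where "N = (\<Prod>r\<in>R. a r)"
  have Npos: "N > 0" unfolding N_def using a by (intro prod_pos) auto
  have aN: "a r dvd N" if "r \<in> R" for r unfolding N_def using R that by (rule dvd_prodI)
  \<comment> \<open>\<open>J i\<close> collects the good rays that reach length \<open>i\<close> at
    an integer parameter, and \<open>g i r\<close> is the permutation reached there.\<close>
  define J where "J i = {r\<in>R. good r \<and> a r dvd int i - b r}" for i :: nat
  define g where "g i r = \<rho> r ((int i - b r) div a r)" for i :: nat and r
  have set_eq: "{w. affine_perm n w \<and> avoids w p \<and> aff_length n w = i} = g i ` J i" if i: "I \<le> i" for i
  proof
    show "{w. affine_perm n w \<and> avoids w p \<and> aff_length n w = i} \<subseteq> g i ` J i"
    proof
      fix w assume "w \<in> {w. affine_perm n w \<and> avoids w p \<and> aff_length n w = i}"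
      then have w: "affine_perm n w" "avoids w p" "aff_length n w = i" by auto
      from cover[OF w(1,2)] obtain w0 v s where "(w0, v) \<in> R" "w = ray n w0 v (int s)" by blast
      then obtain r where r: "r \<in> R" "w = \<rho> r (int s)" by (auto simp: \<rho>_def)
      have len: "window_inv n 0 (\<rho> r (int s)) = int i"
        using aff_length_eq_window_inv[OF w(1) n] w(3) r(2) by simp
      then have sS: "S \<le> s" using I1[OF i r(1), of s] by (cases "s < S") auto
      then have "good r" and ls: "a r * int s + b r = int i" using S[OF r(1) sS] w(2) r(2) len by auto
      then have "int i - b r = a r * int s" by simp
      then have "r \<in> J i" "w = g i r" using r \<open>good r\<close> a[OF r(1)] by (auto simp: J_def g_def)
      then show "w \<in> g i ` J i" by blast
    qed
    show "g i ` J i \<subseteq> {w. affine_perm n w \<and> avoids w p \<and> aff_length n w = i}"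
    proof
      fix w assume "w \<in> g i ` J i"
      then obtain r where r: "r \<in> R" "good r" "a r dvd int i - b r" "w = g i r" by (auto simp: J_def)
      obtain t where t: "int i - b r = a r * t" using r(3) by (auto elim: dvdE)
      have "a r * int S < a r * t" using I2[OF i r(1)] t by linarith
      then have "int S < t" using a[OF r(1)] by simp
      then have "t = int (nat t)" "S \<le> nat t" by auto
      then obtain s where s: "t = int s" "S \<le> s" by blast
      have w: "w = \<rho> r (int s)" using r(4) t s(1) a[OF r(1)] by (simp add: g_def)
      have "affine_perm n w" using aff[OF r(1)] w by simp
      moreover from this have "int (aff_length n w) = int i"
        using aff_length_eq_window_inv[OF _ n] S[OF r(1) s(2)] w t s(1) by simp
      ultimately show "w \<in> {w. affine_perm n w \<and> avoids w p \<and> aff_length n w = i}"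
        using S[OF r(1) s(2)] r(2) w by simp
    qed
  qed
  have J_per: "J (i + nat N) = J i" for i
  proof -
    have "a r dvd int (i + nat N) - b r \<longleftrightarrow> a r dvd int i - b r" if "r \<in> R" for r
    proof -
      have e: "int (i + nat N) - b r = (int i - b r) + N" using Npos by simp
      show ?thesis unfolding e using aN[OF that] by (rule dvd_add_left_iff)
    qed
    then show ?thesis by (auto simp: J_def)
  qed
  have parallel: "a r' * snd r x = a r * snd r' x"
    if i: "I \<le> i" and r: "r \<in> J i" "r' \<in> J i" and eq: "g i r = g i r'" and x: "x \<in> {0..<int n}"
    for i r r' x
  proof (rule ray_eq_imp_parallel[OF n0 x])
    show "ray n (fst r) (snd r) ((int i - b r) div a r) = ray n (fst r') (snd r') ((int i - b r') div a r')"
      using eq by (simp add: g_def \<rho>_def split_def)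
    show "a r * ((int i - b r) div a r) + b r = int i" "a r' * ((int i - b r') div a r') + b r' = int i"
      using r by (auto simp: J_def)
    show "\<bar>a r * a r' * (fst r' x - fst r x)
        + int n * (a r' * b r * snd r x - a r * b r' * snd r' x)\<bar> < int i"
      using I3[OF i _ _ x] r by (simp add: J_def)
  qed
  have g_step: "g (i + nat N) r x = g i r x + int n * ((N div a r) * snd r (x mod int n))"
    if r: "r \<in> J i" for i r x
  proof -
    have rR: "r \<in> R" using r by (simp add: J_def)
    have "(int (i + nat N) - b r) div a r = ((int i - b r) + N) div a r"
      using Npos by (simp add: algebra_simps)
    also have "\<dots> = (int i - b r) div a r + N div a r"
      using aN[OF rR] by (simp add: div_plus_div_distrib_dvd_right)
    finally show ?thesis by (simp add: g_def \<rho>_def split_def ray_add)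
  qed
  have fib: "g i r = g i r' \<longleftrightarrow> g (i + nat N) r = g (i + nat N) r'"
    if i: "I \<le> i" and r: "r \<in> J i" "r' \<in> J i" for i r r'
  proof -
    have rR: "r \<in> R" "r' \<in> R" using r by (auto simp: J_def)
    \<comment> \<open>A coincidence at either of the two lengths makes the rays parallel when
      parametrised by length; an increase of the length by \<open>N\<close> then displaces both by
      the same vector, so the coincidence occurs at both lengths.\<close>
    have same: "(N div a r) * snd r (x mod int n) = (N div a r') * snd r' (x mod int n)"
      if "g i r = g i r' \<or> g (i + nat N) r = g (i + nat N) r'" for x
    proof -
      have x: "x mod int n \<in> {0..<int n}" using n0 by simp
      have par: "a r' * snd r (x mod int n) = a r * snd r' (x mod int n)"
        using that parallel[OF i r _ x] parallel[of "i + nat N" r r', OF _ _ _ _ x] r i J_per by auto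
      obtain m m' where m: "N = a r * m" "N = a r' * m'"
        using aN rR by (meson dvdE)
      define y where "y = snd r (x mod int n)"
      define y' where "y' = snd r' (x mod int n)"
      have pos: "a r > 0" "a r' > 0" using a rR by auto
      have "a r' * (N * y) = N * (a r' * y)" by (simp add: mult.left_commute)
      also have "a r' * y = a r * y'" using par by (simp add: y_def y'_def)
      also have "N * (a r * y') = a r * (N * y')" by (simp add: mult.left_commute)
      finally have "a r' * (a r * m * y) = a r * (a r' * m' * y')" using m by simp
      then have "(a r * a r') * (m * y) = (a r * a r') * (m' * y')" by (simp add: algebra_simps)
      then have "m * y = m' * y'" using pos by simp
      moreover have "N div a r = m" using m(1) pos by simp
      moreover have "N div a r' = m'" unfolding m(2) using pos by simp
      ultimately show ?thesis by (simp add: y_def y'_def)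
    qed
    show ?thesis
    proof
      assume "g i r = g i r'"
      then show "g (i + nat N) r = g (i + nat N) r'"
        using same g_step r by (simp add: fun_eq_iff)
    next
      assume *: "g (i + nat N) r = g (i + nat N) r'"
      show "g i r = g i r'"
      proof
        fix x show "g i r x = g i r' x"
          using fun_cong[OF *, of x] same[of x] * g_step[OF r(1), of x] g_step[OF r(2), of x] by simp
      qed
    qed
  qed
  have "avoid_coeff p n (i + nat N) = avoid_coeff p n i" if i: "I \<le> i" for i
  proof -
    have "avoid_coeff p n (i + nat N) = card (g (i + nat N) ` J i)"
      using set_eq[of "i + nat N"] i J_per by (simp add: avoid_coeff_def)
    also have "\<dots> = card (g i ` J i)"
      by (rule card_image_eq_of_same_fibres) (use fib[OF i] in blast)
    also have "\<dots> = avoid_coeff p n i" using set_eq[OF i] by (simp add: avoid_coeff_def)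
    finally show ?thesis .
  qed
  moreover have "nat N \<ge> 1" using Npos by simp
  ultimately show ?thesis unfolding periodic_for_def by blast
qed

section \<open>Three residue classes\<close>

lemma contains_shift: "contains (\<lambda>x. w x + k) p \<longleftrightarrow> contains w p"
  by (simp add: contains_def)

lemma window_inv_shift: "window_inv n m (\<lambda>x. w x + k) = window_inv n m w"
  by (simp add: window_inv_def)

text \<open>The residues of the window values are a rearrangement of \<open>0, ..., n - 1\<close>,
  so the sum misses its normalized value by \<open>n\<close> times the sum of the quotients.
  Subtracting that sum of quotients from each of the \<open>n\<close> entries repairs it.\<close>

lemma affine_perm_normalize:
  assumes w: "periodic_bij n w" and n: "n > 0"
  shows "\<exists>k. affine_perm n (\<lambda>x. w x + k)"
proof -
  let ?I = "{0..<int n}"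
  define k where "k = - (\<Sum>c\<in>?I. w c div int n)"
  have io: "inj_on (\<lambda>c. w c mod int n) ?I"
  proof (rule inj_onI)
    fix c d assume "c \<in> ?I" "d \<in> ?I" "w c mod int n = w d mod int n"
    then show "c = d" using periodic_bij_inj_mod[OF w n, of c d] by simp
  qed
  have img: "(\<lambda>c. w c mod int n) ` ?I = ?I"
    by (rule endo_inj_surj) (use io n in auto)
  have "(\<Sum>c\<in>?I. w c mod int n) = (\<Sum>c\<in>?I. c)"
    using sum.reindex[OF io, of "\<lambda>c. c"] img by simp
  moreover have "(\<Sum>c\<in>?I. w c) = (\<Sum>c\<in>?I. int n * (w c div int n) + w c mod int n)"
    by (intro sum.cong refl) simp
  ultimately have "(\<Sum>c\<in>?I. w c) = int n * (\<Sum>c\<in>?I. w c div int n) + (\<Sum>c\<in>?I. c)"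
    by (simp only: sum.distrib sum_distrib_left)
  moreover have "(\<Sum>c\<in>?I. w c + k) = (\<Sum>c\<in>?I. w c) + int n * k" by (simp add: sum.distrib)
  ultimately have "(\<Sum>c\<in>?I. w c + k) = (\<Sum>c\<in>?I. c)" by (simp add: k_def)
  moreover have "periodic_bij n (\<lambda>x. w x + k)"
  proof (rule periodic_bijI[OF n])
    show "w (i + int n) + k = w i + k + int n" for i using periodic_bijD(2)[OF w, of i] by simp
    fix c d assume cd: "0 \<le> c" "c < int n" "0 \<le> d" "d < int n" "(w c + k) mod int n = (w d + k) mod int n"
    then have "(w c + k - k) mod int n = (w d + k - k) mod int n" by (intro mod_diff_cong) auto
    then show "c = d" using periodic_bij_inj_mod[OF w n, of c d] cd by simp
  qed
  ultimately show ?thesis by (auto simp: affine_perm_iff)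
qed

text \<open>Up to an additive constant, the general periodic bijection for \<open>n = 3\<close>:
  \<open>e\<close> gives the residues of the window values and \<open>z\<close> the quotients in
  classes 1 and 2, with the quotient in class 0 normalized to 0.\<close>

definition three_lines :: "(int \<Rightarrow> int) \<Rightarrow> int \<times> int \<Rightarrow> int \<Rightarrow> int" where
  "three_lines e z x = 3 * (x div 3) + e (x mod 3)
     + 3 * (of_bool (x mod 3 = 1) * fst z + of_bool (x mod 3 = 2) * snd z)"

lemma periodic_bij_three_lines:
  assumes "inj_on e {0..<3}" "e ` {0..<3} \<subseteq> {0..<3}"
  shows "periodic_bij 3 (three_lines e z)"
proof (rule periodic_bijI)
  show "three_lines e z (i + int 3) = three_lines e z i + int 3" for i
    by (simp add: three_lines_def)
  fix c d assume cd: "0 \<le> c" "c < int 3" "0 \<le> d" "d < int 3"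
    and eq: "three_lines e z c mod int 3 = three_lines e z d mod int 3"
  have m: "three_lines e z x mod 3 = e x" if "x \<in> {0..<3}" for x
  proof -
    have "e x \<in> {0..<3}" using assms(2) that by blast
    moreover have "three_lines e z x = e x + 3 * (of_bool (x = 1) * fst z + of_bool (x = 2) * snd z)"
      using that by (simp add: three_lines_def)
    ultimately show ?thesis by (simp only: mod_mult_self2) simp
  qed
  show "c = d" using eq m[of c] m[of d] cd assms(1) by (simp add: inj_on_def)
qed simp

text \<open>Residue differences lie strictly between -3 and 3, so each of the three floors differs
  from the quotient difference by at most one; the remaining \<open>\<bar>y - x\<bar>\<close> is at
  most \<open>\<bar>x\<bar> + \<bar>y\<bar>\<close>.\<close>

lemma window_inv_three_lines_le:
  assumes e: "e ` {0..<3} \<subseteq> {0..<3}"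
  shows "window_inv 3 0 (three_lines e (x, y)) \<le> 2 * \<bar>x\<bar> + 2 * \<bar>y\<bar> + 3"
proof -
  have "{0..<3} = {0, 1, 2::int}" by auto
  moreover have "{0<..<3} = {1, 2::int}" "{1<..<3} = {2::int}" "{2<..<3::int} = {}" by auto
  ultimately have w: "window_inv 3 0 u = \<bar>(u 1 - u 0) div 3\<bar> + \<bar>(u 2 - u 0) div 3\<bar> + \<bar>(u 2 - u 1) div 3\<bar>"
    for u :: "int \<Rightarrow> int" by (simp add: window_inv_def)
  have "0 \<in> {0..<3::int}" "1 \<in> {0..<3::int}" "2 \<in> {0..<3::int}" by auto
  then have "e 0 \<in> {0..<3}" "e 1 \<in> {0..<3}" "e 2 \<in> {0..<3}" using e by blast+
  then have E: "0 \<le> e 0" "e 0 < 3" "0 \<le> e 1" "e 1 < 3" "0 \<le> e 2" "e 2 < 3" by auto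
  have t: "three_lines e (x, y) 0 = e 0" "three_lines e (x, y) 1 = e 1 + 3 * x"
    "three_lines e (x, y) 2 = e 2 + 3 * y" by (simp_all add: three_lines_def)
  have b: "\<bar>(d + 3 * a) div 3\<bar> \<le> \<bar>a\<bar> + 1" if "- 3 < d" "d < 3" for a d :: int
  proof -
    have "(d + 3 * a) div 3 = a + d div 3" by simp
    moreover have "- 1 \<le> d div 3" "d div 3 \<le> 0" using that by auto
    ultimately show ?thesis by linarith
  qed
  have "(e 1 + 3 * x - e 0) = (e 1 - e 0) + 3 * x" "(e 2 + 3 * y - e 0) = (e 2 - e 0) + 3 * y"
    "(e 2 + 3 * y - (e 1 + 3 * x)) = (e 2 - e 1) + 3 * (y - x)" by auto
  then show ?thesis
    unfolding w t using b[of "e 1 - e 0" x] b[of "e 2 - e 0" y] b[of "e 2 - e 1" "y - x"] E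
    by linarith
qed

lemma avoiders_length_le:
  assumes "n \<ge> 2" "\<And>i. avoid_coeff p n i \<le> B"
  shows "finite {w. affine_perm n w \<and> avoids w p \<and> aff_length n w \<le> l}"
    and "card {w. affine_perm n w \<and> avoids w p \<and> aff_length n w \<le> l} \<le> (l + 1) * B"
proof -
  let ?A = "\<lambda>i. {w. affine_perm n w \<and> avoids w p \<and> aff_length n w = i}"
  have eq: "{w. affine_perm n w \<and> avoids w p \<and> aff_length n w \<le> l} = (\<Union>i\<in>{..l}. ?A i)" by auto
  have "finite (?A i)" for i
    by (rule finite_subset[OF _ finite_affine_perm_length[OF assms(1), of i]]) auto
  then show "finite {w. affine_perm n w \<and> avoids w p \<and> aff_length n w \<le> l}" unfolding eq by blast
  have "card (\<Union>i\<in>{..l}. ?A i) \<le> (\<Sum>i\<in>{..l}. card (?A i))" by (rule card_UN_le) simp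
  also have "\<dots> \<le> (\<Sum>i\<in>{..l}. B)"
    by (intro sum_mono) (use assms(2) in \<open>simp add: avoid_coeff_def\<close>)
  finally show "card {w. affine_perm n w \<and> avoids w p \<and> aff_length n w \<le> l} \<le> (l + 1) * B"
    unfolding eq by simp
qed

text \<open>If no bounded relation holds, then avoidance is governed by the signs of linear forms that
  all stay away from \<open>0\<close>, so a whole square around a large multiple of the point avoids
  the pattern as well; that is too many avoiders of linearly bounded length.\<close>

lemma three_lines_relation:
  assumes p: "distinct p" and B: "\<And>i. avoid_coeff p 3 i \<le> B"
    and e: "inj_on e {0..<3}" "e ` {0..<3} \<subseteq> {0..<3}"
  shows "\<exists>C\<ge>1. \<forall>x y. avoids (three_lines e (x, y)) p \<longrightarrow>
    (\<exists>\<alpha> \<beta>. (\<alpha> \<noteq> 0 \<or> \<beta> \<noteq> 0) \<and> \<bar>\<alpha>\<bar> \<le> C \<and> \<bar>\<beta>\<bar> \<le> C \<and> \<bar>\<alpha> * x + \<beta> * y\<bar> \<le> C)"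
proof -
  define L where "L = {f :: int \<times> int \<Rightarrow> int. \<exists>\<alpha> \<beta> \<gamma>. f = (\<lambda>z. \<alpha> * fst z + \<beta> * snd z + \<gamma>)}"
  have add: "(\<lambda>z. f z + g z) \<in> L" if fg: "f \<in> L" "g \<in> L" for f g
  proof -
    obtain \<alpha> \<beta> \<gamma> \<alpha>' \<beta>' \<gamma>' where "f = (\<lambda>z. \<alpha> * fst z + \<beta> * snd z + \<gamma>)"
      "g = (\<lambda>z. \<alpha>' * fst z + \<beta>' * snd z + \<gamma>')"
      using fg unfolding L_def by blast
    then have "(\<lambda>z. f z + g z) = (\<lambda>z. (\<alpha> + \<alpha>') * fst z + (\<beta> + \<beta>') * snd z + (\<gamma> + \<gamma>'))"
      by (simp add: fun_eq_iff algebra_simps)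
    then show ?thesis unfolding L_def by blast
  qed
  have const: "(\<lambda>_. k) \<in> L" for k
    unfolding L_def by (intro CollectI exI[of _ 0] exI[of _ k]) simp
  have gap: "(\<lambda>z. (three_lines e z d - three_lines e z c - 1) div int 3) \<in> L"
    if cd: "c \<in> {0..<int 3}" "d \<in> {0..<int 3}" for c d
  proof -
    have "three_lines e z d - three_lines e z c - 1 = (e d - e c - 1)
        + 3 * ((of_bool (d = 1) - of_bool (c = 1)) * fst z + (of_bool (d = 2) - of_bool (c = 2)) * snd z)" for z
      using cd by (simp add: three_lines_def algebra_simps)
    then have "(\<lambda>z. (three_lines e z d - three_lines e z c - 1) div int 3)
       = (\<lambda>z. (of_bool (d = 1) - of_bool (c = 1)) * fst z + (of_bool (d = 2) - of_bool (c = 2)) * snd z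
            + (e d - e c - 1) div 3)"
      by (simp only: of_nat_numeral) (rule ext, subst div_mult_self2, auto)
    then show ?thesis unfolding L_def by blast
  qed
  have "(3::nat) > 0" by simp
  from contains_family[OF this p periodic_bij_three_lines[OF e] add const gap]
  obtain \<F> where \<F>: "finite \<F>" "\<And>F. F \<in> \<F> \<Longrightarrow> finite F \<and> F \<subseteq> L"
    "\<And>z. contains (three_lines e z) p \<longleftrightarrow> (\<exists>F\<in>\<F>. \<forall>f\<in>F. 0 \<le> f z)"
    by blast
  have finU: "finite (\<Union>\<F>)" using \<F> by blast
  have "\<forall>f\<in>\<Union>\<F>. \<exists>t. f = (\<lambda>z. fst t * fst z + fst (snd t) * snd z + snd (snd t))"
    using \<F>(2) unfolding L_def by fastforce
  from bchoice[OF this] obtain t where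
    t: "\<forall>f\<in>\<Union>\<F>. f = (\<lambda>z. fst (t f) * fst z + fst (snd (t f)) * snd z + snd (snd (t f)))" ..
  \<comment> \<open>A common bound for all coefficients and constant terms of the finitely many
    forms that govern containment.\<close>
  define C where "C = 1 + (\<Sum>f\<in>\<Union>\<F>. \<bar>fst (t f)\<bar> + \<bar>fst (snd (t f))\<bar> + \<bar>snd (snd (t f))\<bar>)"
  have C1: "C \<ge> 1" unfolding C_def by (simp add: sum_nonneg)
  have coef: "\<exists>\<alpha> \<beta> \<gamma>. (\<forall>z. f z = \<alpha> * fst z + \<beta> * snd z + \<gamma>) \<and> \<bar>\<alpha>\<bar> \<le> C \<and> \<bar>\<beta>\<bar> \<le> C \<and> \<bar>\<gamma>\<bar> \<le> C"
    if f: "f \<in> F" "F \<in> \<F>" for f F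
  proof -
    have fU: "f \<in> \<Union>\<F>" using f by blast
    have "\<bar>fst (t f)\<bar> + \<bar>fst (snd (t f))\<bar> + \<bar>snd (snd (t f))\<bar> \<le> C - 1"
      unfolding C_def using member_le_sum[OF fU, of "\<lambda>f. \<bar>fst (t f)\<bar> + \<bar>fst (snd (t f))\<bar> + \<bar>snd (snd (t f))\<bar>"] finU
      by simp
    then have b: "\<bar>fst (t f)\<bar> \<le> C" "\<bar>fst (snd (t f))\<bar> \<le> C" "\<bar>snd (snd (t f))\<bar> \<le> C" by auto
    have "\<forall>z. f z = fst (t f) * fst z + fst (snd (t f)) * snd z + snd (snd (t f))"
      using bspec[OF t fU] by (rule fun_cong[THEN allI])
    then show ?thesis using b by blast
  qed
  have "\<exists>\<alpha> \<beta>. (\<alpha> \<noteq> 0 \<or> \<beta> \<noteq> 0) \<and> \<bar>\<alpha>\<bar> \<le> C \<and> \<bar>\<beta>\<bar> \<le> C \<and> \<bar>\<alpha> * x + \<beta> * y\<bar> \<le> C"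
    if av: "avoids (three_lines e (x, y)) p" for x y
  proof (rule ccontr)
    assume "\<not> ?thesis"
    then have far: "C < \<bar>\<alpha> * x + \<beta> * y\<bar>"
      if "\<alpha> \<noteq> 0 \<or> \<beta> \<noteq> 0" "\<bar>\<alpha>\<bar> \<le> C" "\<bar>\<beta>\<bar> \<le> C" for \<alpha> \<beta> using that by (meson not_le)
    \<comment> \<open>The factor \<open>2 * m + 1\<close> is chosen so that a linear part of at most
      \<open>- (C + 1)\<close> becomes at most \<open>- 2 * C * m - 2 * m - C - 1\<close>. This
      outweighs the change of at most \<open>2 * C * m\<close> within the square and the constant
      term of at most \<open>C\<close>.\<close>
    have square: "avoids (three_lines e ((2 * m + 1) * x + s, (2 * m + 1) * y + r)) p"
      if m: "0 \<le> m" "0 \<le> s" "s \<le> m" "0 \<le> r" "r \<le> m" for m s r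
    proof -
      let ?z = "((2 * m + 1) * x + s, (2 * m + 1) * y + r)"
      have "\<exists>f\<in>F. f ?z < 0" if F: "F \<in> \<F>" for F
      proof -
        have "\<not> (\<forall>f\<in>F. 0 \<le> f (x, y))"
          using av F \<F>(3)[of "(x, y)"] by (auto simp: avoids_def)
        then obtain f where f: "f \<in> F" "f (x, y) < 0" by (auto simp: not_le)
        obtain \<alpha> \<beta> \<gamma> where fz: "\<And>z. f z = \<alpha> * fst z + \<beta> * snd z + \<gamma>"
          and b: "\<bar>\<alpha>\<bar> \<le> C" "\<bar>\<beta>\<bar> \<le> C" "\<bar>\<gamma>\<bar> \<le> C" using coef[OF f(1) F] by blast
        have "f ?z < 0"
        proof (cases "\<alpha> = 0 \<and> \<beta> = 0")
          case True
          then show ?thesis using f(2) fz by simp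
        next
          case False
          have "\<alpha> * x + \<beta> * y + \<gamma> < 0" using f(2) fz by simp
          \<comment> \<open>\<open>far\<close> keeps the linear part out of the interval from
            \<open>- C\<close> to \<open>C\<close>, where the constant term lies; hence a negative
            form has a negative linear part.\<close>
          then have neg: "\<alpha> * x + \<beta> * y \<le> - (C + 1)" using far[of \<alpha> \<beta>] False b by linarith
          have le: "a * u \<le> C * m" if "\<bar>a\<bar> \<le> C" "0 \<le> u" "u \<le> m" for a u
          proof -
            have "a * u \<le> C * u" by (rule mult_right_mono) (use that in auto)
            also have "\<dots> \<le> C * m" by (rule mult_left_mono) (use that C1 in auto)
            finally show ?thesis .
          qed
          have "\<alpha> * s \<le> C * m" "\<beta> * r \<le> C * m" using le b m by auto
          moreover have "(2 * m + 1) * (\<alpha> * x + \<beta> * y) \<le> (2 * m + 1) * (- (C + 1))"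
            using neg m by (intro mult_left_mono) auto
          moreover have "f ?z = (2 * m + 1) * (\<alpha> * x + \<beta> * y) + \<alpha> * s + \<beta> * r + \<gamma>"
            unfolding fz by (simp add: algebra_simps)
          moreover have "(2 * m + 1) * (- (C + 1)) = - 2 * (C * m) - 2 * m - C - 1"
            by (simp add: algebra_simps)
          ultimately show ?thesis using b(3) m by linarith
        qed
        then show ?thesis using f(1) by blast
      qed
      then have "\<not> contains (three_lines e ?z) p" unfolding \<F>(3) by (meson not_le)
      then show ?thesis by (simp add: avoids_def)
    qed
    \<comment> \<open>Chosen so that \<open>D * (m + 1)\<close> bounds the length at every point of
      the square of side \<open>m\<close>.\<close>
    define D where "D = nat (4 * (\<bar>x\<bar> + \<bar>y\<bar>) + 4)"
    \<comment> \<open>The square supplies \<open>(m + 1) * (m + 1)\<close> distinct avoiders, while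
      there are at most \<open>B\<close> for each of the \<open>D * (m + 1) + 1\<close> available
      lengths.\<close>
    have bound: "(m + 1) * (m + 1) \<le> (D * (m + 1) + 1) * B" for m :: nat
    proof -
      let ?pt = "\<lambda>(s, r). ((2 * int m + 1) * x + int s, (2 * int m + 1) * y + int r)"
      let ?A = "{w. affine_perm 3 w \<and> avoids w p \<and> aff_length 3 w \<le> D * (m + 1)}"
      have "\<forall>q. \<exists>k. affine_perm 3 (\<lambda>u. three_lines e (?pt q) u + k)"
        using affine_perm_normalize[OF periodic_bij_three_lines[OF e]] by simp
      then obtain k where k: "\<And>q. affine_perm 3 (\<lambda>u. three_lines e (?pt q) u + k q)" by metis
      let ?h = "\<lambda>q u. three_lines e (?pt q) u + k q"
      have inj: "inj_on ?h ({..m} \<times> {..m})"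
      proof (rule inj_onI)
        fix q q' assume eq: "?h q = ?h q'"
        obtain s r s' r' where q: "q = (s, r)" "q' = (s', r')" by fastforce
        \<comment> \<open>The normalizing constants may differ from point to point; differences to
          the value at 0 are free of them.\<close>
        have "?h q 1 - ?h q 0 = ?h q' 1 - ?h q' 0" "?h q 2 - ?h q 0 = ?h q' 2 - ?h q' 0"
          using eq by (metis)+
        then show "q = q'" by (simp add: q three_lines_def)
      qed
      have "?h q \<in> ?A" if qm: "q \<in> {..m} \<times> {..m}" for q
      proof -
        obtain s r where q: "q = (s, r)" "s \<le> m" "r \<le> m" using qm by auto
        let ?x = "(2 * int m + 1) * x + int s" and ?y = "(2 * int m + 1) * y + int r"
        have "avoids (three_lines e (?pt q)) p"
          using square[of "int m" "int s" "int r"] q by simp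
        then have a: "avoids (?h q) p" by (simp add: avoids_def contains_shift)
        have "int (aff_length 3 (?h q)) = window_inv 3 0 (three_lines e (?x, ?y))"
          using aff_length_eq_window_inv[OF k[of q]] by (simp add: window_inv_shift q(1))
        also have "\<dots> \<le> 2 * \<bar>?x\<bar> + 2 * \<bar>?y\<bar> + 3"
          by (rule window_inv_three_lines_le[OF e(2)])
        also have "\<dots> \<le> int D * (int m + 1)"
        proof -
          have arith: "2 * X + 2 * Y + 3 \<le> Z"
            if "X \<le> P + M" "Y \<le> Q + M" "Z = 2 * P + 2 * Q + 2 * \<bar>x\<bar> + 2 * \<bar>y\<bar> + 4 * M + 4"
            for X Y Z P Q M :: int using that by linarith
          have "\<bar>?x\<bar> \<le> (2 * int m + 1) * \<bar>x\<bar> + int m"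
            using abs_triangle_ineq[of "(2 * int m + 1) * x" "int s"] q(2) by (simp add: abs_mult)
          moreover have "\<bar>?y\<bar> \<le> (2 * int m + 1) * \<bar>y\<bar> + int m"
            using abs_triangle_ineq[of "(2 * int m + 1) * y" "int r"] q(3) by (simp add: abs_mult)
          moreover have "int D * (int m + 1) = 2 * ((2 * int m + 1) * \<bar>x\<bar>) + 2 * ((2 * int m + 1) * \<bar>y\<bar>)
              + 2 * \<bar>x\<bar> + 2 * \<bar>y\<bar> + 4 * int m + 4"
            by (simp add: D_def algebra_simps)
          ultimately show ?thesis by (rule arith)
        qed
        also have "\<dots> = int (D * (m + 1))" by (simp add: algebra_simps)
        finally have "aff_length 3 (?h q) \<le> D * (m + 1)" by (simp only: of_nat_le_iff)
        then show ?thesis using a k[of q] by simp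
      qed
      then have "?h ` ({..m} \<times> {..m}) \<subseteq> ?A" by (rule image_subsetI)
      from card_inj_on_le[OF inj this avoiders_length_le(1)[OF _ B]]
      have "card ({..m} \<times> {..m}) \<le> card ?A" by simp
      also have "\<dots> \<le> (D * (m + 1) + 1) * B" by (rule avoiders_length_le(2)[OF _ B]) simp
      finally show ?thesis by simp
    qed
    \<comment> \<open>With this \<open>m\<close> the linear bound is at most
      \<open>m * (m + 1)\<close>, less than the number of points in the square.\<close>
    define m where "m = (D + 1) * B"
    have "(m + 1) * (m + 1) \<le> (D * (m + 1) + 1) * B" by (rule bound)
    also have "\<dots> \<le> ((D + 1) * (m + 1)) * B" by (intro mult_right_mono) auto
    also have "\<dots> = ((D + 1) * B) * (m + 1)" by (simp only: mult_ac)
    also have "\<dots> = m * (m + 1)" by (simp only: m_def)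
    finally show False by simp
  qed
  then show ?thesis using C1 by blast
qed

text \<open>There are finitely many residue patterns \<open>e\<close>, so one constant serves them
  all. Subtracting three times the quotient of \<open>w 0\<close> brings any periodic bijection into
  the form \<open>three_lines\<close>.\<close>

lemma periodic_bij_3_relation:
  assumes p: "distinct p" and B: "\<And>i. avoid_coeff p 3 i \<le> B"
  shows "\<exists>C\<ge>1. \<forall>w. periodic_bij 3 w \<longrightarrow> avoids w p \<longrightarrow>
    (\<exists>\<alpha> \<beta>. (\<alpha> \<noteq> 0 \<or> \<beta> \<noteq> 0) \<and> \<bar>\<alpha>\<bar> \<le> C \<and> \<bar>\<beta>\<bar> \<le> C \<and>
       \<bar>\<alpha> * (w 1 div 3 - w 0 div 3) + \<beta> * (w 2 div 3 - w 0 div 3)\<bar> \<le> C)"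
proof -
  define E where "E = {e \<in> PiE {0..<3::int} (\<lambda>_. {0..<3::int}). inj_on e {0..<3}}"
  have finE: "finite E"
    unfolding E_def by (rule finite_subset[of _ "PiE {0..<3::int} (\<lambda>_. {0..<3::int})"]) (auto intro!: finite_PiE)
  have "\<forall>e\<in>E. \<exists>C\<ge>1. \<forall>x y. avoids (three_lines e (x, y)) p \<longrightarrow>
    (\<exists>\<alpha> \<beta>. (\<alpha> \<noteq> 0 \<or> \<beta> \<noteq> 0) \<and> \<bar>\<alpha>\<bar> \<le> C \<and> \<bar>\<beta>\<bar> \<le> C \<and> \<bar>\<alpha> * x + \<beta> * y\<bar> \<le> C)"
  proof
    fix e assume "e \<in> E"
    then have "inj_on e {0..<3}" "e ` {0..<3} \<subseteq> {0..<3}" by (auto simp: E_def PiE_def Pi_def)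
    from three_lines_relation[OF p B this]
    show "\<exists>C\<ge>1. \<forall>x y. avoids (three_lines e (x, y)) p \<longrightarrow>
    (\<exists>\<alpha> \<beta>. (\<alpha> \<noteq> 0 \<or> \<beta> \<noteq> 0) \<and> \<bar>\<alpha>\<bar> \<le> C \<and> \<bar>\<beta>\<bar> \<le> C \<and> \<bar>\<alpha> * x + \<beta> * y\<bar> \<le> C)" .
  qed
  from bchoice[OF this] obtain Cf where Cf: "\<forall>e\<in>E. Cf e \<ge> 1 \<and> (\<forall>x y. avoids (three_lines e (x, y)) p \<longrightarrow>
    (\<exists>\<alpha> \<beta>. (\<alpha> \<noteq> 0 \<or> \<beta> \<noteq> 0) \<and> \<bar>\<alpha>\<bar> \<le> Cf e \<and> \<bar>\<beta>\<bar> \<le> Cf e \<and> \<bar>\<alpha> * x + \<beta> * y\<bar> \<le> Cf e))" ..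
  define C where "C = 1 + (\<Sum>e\<in>E. Cf e)"
  have Cf0: "Cf e \<ge> 0" if "e \<in> E" for e using Cf that by force
  have C1: "C \<ge> 1" unfolding C_def using Cf0 by (simp add: sum_nonneg)
  have CfC: "Cf e \<le> C" if "e \<in> E" for e
    using member_le_sum[OF that, of Cf] Cf0 finE unfolding C_def by auto
  have "\<exists>\<alpha> \<beta>. (\<alpha> \<noteq> 0 \<or> \<beta> \<noteq> 0) \<and> \<bar>\<alpha>\<bar> \<le> C \<and> \<bar>\<beta>\<bar> \<le> C \<and>
       \<bar>\<alpha> * (w 1 div 3 - w 0 div 3) + \<beta> * (w 2 div 3 - w 0 div 3)\<bar> \<le> C"
    if w: "periodic_bij 3 w" and av: "avoids w p" for w
  proof -
    define e where "e = restrict (\<lambda>c. w c mod 3) {0..<3}"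
    let ?x = "w 1 div 3 - w 0 div 3" and ?y = "w 2 div 3 - w 0 div 3"
    have "inj_on e {0..<3}"
    proof (rule inj_onI)
      fix c d :: int assume "c \<in> {0..<3}" "d \<in> {0..<3}" "e c = e d"
      then show "c = d" using periodic_bij_inj_mod[OF w, of c d] by (simp add: e_def)
    qed
    then have eE: "e \<in> E" by (auto simp: E_def e_def)
    have weq: "w x = three_lines e (?x, ?y) x + 3 * (w 0 div 3)" for x
    proof -
      have "w x = 3 * (x div 3) + w (x mod 3)"
        using periodic_window[of w 3 x, OF periodic_bijD(2)[OF w]] by simp
      moreover have "w (x mod 3) = 3 * (w (x mod 3) div 3) + e (x mod 3)" by (simp add: e_def)
      moreover have "x mod 3 = 0 \<or> x mod 3 = 1 \<or> x mod 3 = 2" by presburger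
      ultimately show ?thesis by (elim disjE) (simp_all add: three_lines_def)
    qed
    have "w = (\<lambda>x. three_lines e (?x, ?y) x + 3 * (w 0 div 3))" by (rule ext) (rule weq)
    then have "avoids (three_lines e (?x, ?y)) p"
      using av contains_shift[of "three_lines e (?x, ?y)" "3 * (w 0 div 3)" p] by (simp add: avoids_def)
    then obtain \<alpha> \<beta> where "\<alpha> \<noteq> 0 \<or> \<beta> \<noteq> 0" "\<bar>\<alpha>\<bar> \<le> Cf e" "\<bar>\<beta>\<bar> \<le> Cf e" "\<bar>\<alpha> * ?x + \<beta> * ?y\<bar> \<le> Cf e"
      using Cf eE by blast
    then show ?thesis using CfC[OF eE] 
      by (intro exI[of _ \<alpha>] exI[of _ \<beta>] conjI) (blast intro: order_trans)+
  qed
  then show ?thesis using C1 by blast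
qed

section \<open>All residue classes\<close>

text \<open>Once the quotients are known, only the order of the residues matters; this allows
  residues modulo \<open>n\<close> to be replaced by ranks modulo 3.\<close>

lemma lex_less_iff:
  fixes n :: int
  assumes "0 \<le> r" "r < n" "0 \<le> r'" "r' < n"
  shows "n * Q + r < n * Q' + r' \<longleftrightarrow> Q < Q' \<or> Q = Q' \<and> r < r'"
proof -
  consider "Q < Q'" | "Q = Q'" | "Q' < Q" by linarith
  then show ?thesis
  proof cases
    case 1
    then have "n * (Q + 1) \<le> n * Q'" using assms by (intro mult_left_mono) auto
    then show ?thesis using 1 assms by (simp add: distrib_left)
  next
    case 3
    then have "n * (Q' + 1) \<le> n * Q" using assms by (intro mult_left_mono) auto
    then show ?thesis using 3 assms by (simp add: distrib_left)
  qed simp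
qed

text \<open>Standardizing the residue classes \<open>0\<close>, \<open>i\<close>, \<open>j\<close> of \<open>w\<close> gives a 3-periodic bijection
  whose patterns all occur in \<open>w\<close>.\<close>

lemma restrict_to_three_classes:
  assumes w: "periodic_bij n w" and n: "n > 0" and ij: "0 < i" "i < j" "j < int n"
  shows "\<exists>u. periodic_bij 3 u \<and> u 0 div 3 = w 0 div int n \<and> u 1 div 3 = w i div int n \<and>
    u 2 div 3 = w j div int n \<and> (\<forall>p. contains u p \<longrightarrow> contains w p)"
proof -
  define c where "c a = (if a = 0 then 0 else if a = 1 then i else j)" for a :: int
  define e where "e a = w (c a) mod int n" for a
  define q where "q a = w (c a) div int n" for a
  \<comment> \<open>The rank, from 0 to 2, of the residue of class \<open>a\<close> among the three
    distinct residues.\<close>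
  define r where "r a = (of_bool (e 0 < e a) + of_bool (e 1 < e a) + of_bool (e 2 < e a) :: int)" for a
  define u where "u x = 3 * (x div 3 + q (x mod 3)) + r (x mod 3)" for x
  have m3: "x mod 3 = 0 \<or> x mod 3 = 1 \<or> x mod 3 = 2" for x :: int by presburger
  have n0: "int n > 0" using n by simp
  have ce: "e a = e b \<Longrightarrow> c a mod int n = c b mod int n" for a b
    using periodic_bij_inj_mod[OF w n, of "c a" "c b"] by (simp add: e_def)
  have ne: "e 0 \<noteq> e 1" "e 0 \<noteq> e 2" "e 1 \<noteq> e 2"
    using ce[of 0 1] ce[of 0 2] ce[of 1 2] ij by (auto simp: c_def)
  have r_bounds: "0 \<le> r (x mod 3) \<and> r (x mod 3) < 3" for x
    using m3[of x] by (auto simp: r_def)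
  have e_bounds: "0 \<le> e a \<and> e a < int n" for a using n0 by (simp add: e_def)
  have r_less: "r (x mod 3) < r (y mod 3) \<longleftrightarrow> e (x mod 3) < e (y mod 3)" for x y
    using m3[of x] m3[of y] ne by (elim disjE) (simp_all add: r_def of_bool_def)
  have "periodic_bij 3 u"
  proof (rule periodic_bijI)
    show "u (k + int 3) = u k + int 3" for k by (simp add: u_def)
    fix a b assume ab: "0 \<le> a" "a < int 3" "0 \<le> b" "b < int 3" "u a mod int 3 = u b mod int 3"
    have um: "u x mod 3 = r (x mod 3)" for x
      unfolding u_def mod_mult_self4 using r_bounds[of x] by simp
    have "r (a mod 3) = r (b mod 3)" using ab(5) um by simp
    then have "e (a mod 3) = e (b mod 3)" using r_less[of a b] r_less[of b a] by linarith
    then have "a mod 3 = b mod 3" using m3[of a] m3[of b] ne by auto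
    then show "a = b" using ab by simp
  qed simp
  moreover have ud: "u x div 3 = x div 3 + q (x mod 3)" for x
    unfolding u_def using r_bounds[of x] by (intro int_div_pos_eq[of _ _ _ "r (x mod 3)"]) auto
  moreover have "contains w p" if u: "contains u p" for p
  proof -
    \<comment> \<open>The increasing embedding of the positions of \<open>u\<close> onto the three
      chosen classes of \<open>w\<close>; it carries occurrences of a pattern in \<open>u\<close> to
      occurrences in \<open>w\<close>.\<close>
    define \<phi> where "\<phi> x = int n * (x div 3) + c (x mod 3)" for x
    have c_bounds: "0 \<le> c a \<and> c a < int n" for a using ij by (simp add: c_def)
    have mono: "\<phi> x < \<phi> y" if "x < y" for x y
    proof -
      have "x div 3 < y div 3 \<or> x div 3 = y div 3 \<and> x mod 3 < y mod 3"
        using that lex_less_iff[of "x mod 3" 3 "y mod 3" "x div 3" "y div 3"] by simp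
      moreover have "c (x mod 3) < c (y mod 3)" if "x mod 3 < y mod 3"
        using that m3[of x] m3[of y] ij by (auto simp: c_def)
      ultimately show ?thesis
        unfolding \<phi>_def using lex_less_iff[of "c (x mod 3)" "int n" "c (y mod 3)"] c_bounds by blast
    qed
    have w\<phi>: "w (\<phi> x) = int n * (x div 3 + q (x mod 3)) + e (x mod 3)" for x
    proof -
      have "w (\<phi> x) = w (c (x mod 3)) + int n * (x div 3)"
        unfolding \<phi>_def using periodic_shift[of w n, OF periodic_bijD(2)[OF w]]
        by (simp only: add.commute)
      moreover have "w (c (x mod 3)) = int n * q (x mod 3) + e (x mod 3)"
        by (simp add: q_def e_def)
      ultimately show ?thesis by (simp add: distrib_left)
    qed
    have order: "w (\<phi> x) < w (\<phi> y) \<longleftrightarrow> u x < u y" for x y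
    proof -
      have "w (\<phi> x) < w (\<phi> y) \<longleftrightarrow> x div 3 + q (x mod 3) < y div 3 + q (y mod 3) \<or>
          x div 3 + q (x mod 3) = y div 3 + q (y mod 3) \<and> e (x mod 3) < e (y mod 3)"
        unfolding w\<phi> by (rule lex_less_iff) (use e_bounds in auto)
      moreover have "u x < u y \<longleftrightarrow> x div 3 + q (x mod 3) < y div 3 + q (y mod 3) \<or>
          x div 3 + q (x mod 3) = y div 3 + q (y mod 3) \<and> r (x mod 3) < r (y mod 3)"
        unfolding u_def by (rule lex_less_iff) (use r_bounds in auto)
      ultimately show ?thesis by (simp only: r_less)
    qed
    obtain ix where "\<forall>a b. a < b \<and> b < length p \<longrightarrow> ix a < ix b"
      "\<forall>a b. a < length p \<and> b < length p \<longrightarrow> (u (ix a) < u (ix b) \<longleftrightarrow> p ! a < p ! b)"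
      using u unfolding contains_def by blast
    then show ?thesis unfolding contains_def
      by (intro exI[of _ "\<lambda>a. \<phi> (ix a)"]) (simp add: mono order)
  qed
  moreover have "q 0 = w 0 div int n" "q 1 = w i div int n" "q 2 = w j div int n"
    by (simp_all add: q_def c_def)
  ultimately show ?thesis by (intro exI[of _ u]) simp
qed

text \<open>Pairwise relations with the dominant coordinate \<open>i\<close> determine all the others up to bounded
  error; working modulo \<open>n * fact C\<close> keeps the direction \<open>v\<close> integral.\<close>

lemma bounded_relations_line:
  fixes q :: "int \<Rightarrow> int" and C :: nat
  assumes n: "n \<ge> 2" and C: "C \<ge> 1"
    and rel: "\<And>i j. i \<in> {1..<int n} \<Longrightarrow> j \<in> {1..<int n} \<Longrightarrow>
      \<exists>\<alpha> \<beta>. (\<alpha> \<noteq> 0 \<or> \<beta> \<noteq> 0) \<and> \<bar>\<alpha>\<bar> \<le> int C \<and> \<bar>\<beta>\<bar> \<le> int C \<and>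
        \<bar>\<alpha> * (q i - q 0) + \<beta> * (q j - q 0)\<bar> \<le> int C"
  shows "\<exists>v (s::nat). (\<Sum>c\<in>{0..<int n}. v c) = 0 \<and> (\<exists>c\<in>{0..<int n}. v c \<noteq> 0) \<and>
    (\<forall>c. c \<notin> {0..<int n} \<longrightarrow> v c = 0) \<and>
    (\<forall>c\<in>{0..<int n}. \<bar>v c\<bar> \<le> 2 * int n * int C * fact C) \<and>
    (\<forall>c\<in>{0..<int n}. \<bar>(q c - q 0) - int s * (v c - v 0)\<bar> \<le> int C + int C * (int n * fact C))"
proof -
  let ?I = "{0..<int n}" and ?J = "{1..<int n}"
  have I: "?I = insert 0 ?J" using n by auto
  define F :: int where "F = fact C"
  have F1: "F \<ge> 1" unfolding F_def by (rule fact_ge_1)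
  have CF: "1 * 1 \<le> int C * F" using C F1 by (intro mult_mono) auto
  define X where "X c = q c - q 0" for c
  have "?J \<noteq> {}" using n by auto
  then obtain i where i: "i \<in> ?J" and imax: "\<And>j. j \<in> ?J \<Longrightarrow> \<bar>X j\<bar> \<le> \<bar>X i\<bar>"
  proof -
    have "Max ((\<lambda>j. \<bar>X j\<bar>) ` ?J) \<in> (\<lambda>j. \<bar>X j\<bar>) ` ?J" using \<open>?J \<noteq> {}\<close> by (intro Max_in) auto
    then obtain i where "i \<in> ?J" "Max ((\<lambda>j. \<bar>X j\<bar>) ` ?J) = \<bar>X i\<bar>" by auto
    then show ?thesis using that[of i] Max_ge[of "(\<lambda>j. \<bar>X j\<bar>) ` ?J"] by auto
  qed
  show ?thesis
  proof (cases "\<bar>X i\<bar> \<le> int C")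
    case True
    \<comment> \<open>All differences are bounded here, so \<open>s = 0\<close> works with any
      admissible direction; this is one that is nonzero with sum 0.\<close>
    define v where "v c = (if c = 0 then 1 else if c = 1 then - 1 else 0 :: int)" for c :: int
    have "?I = insert 0 (insert 1 {2..<int n})" using n by auto
    moreover have "(\<Sum>c\<in>{2..<int n}. v c) = 0" by (intro sum.neutral) (auto simp: v_def)
    ultimately have "(\<Sum>c\<in>?I. v c) = 0" by (simp add: v_def)
    moreover have "\<exists>c\<in>?I. v c \<noteq> 0" using n by (intro bexI[of _ 0]) (auto simp: v_def)
    moreover have "\<forall>c. c \<notin> ?I \<longrightarrow> v c = 0" using n by (auto simp: v_def)
    moreover have "\<forall>c\<in>?I. \<bar>v c\<bar> \<le> 2 * int n * int C * fact C"
    proof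
      fix c
      have "1 * 1 \<le> (2 * int n) * (int C * F)" by (rule mult_mono) (use CF n in auto)
      then show "\<bar>v c\<bar> \<le> 2 * int n * int C * fact C" by (auto simp: v_def F_def mult.assoc)
    qed
    moreover have "\<forall>c\<in>?I. \<bar>(q c - q 0) - int 0 * (v c - v 0)\<bar> \<le> int C + int C * (int n * fact C)"
    proof
      fix c assume "c \<in> ?I"
      then have "\<bar>X c\<bar> \<le> int C" using imax[of c] True unfolding I by (auto simp: X_def)
      moreover have "0 \<le> int C * (int n * fact C)" by simp
      ultimately show "\<bar>(q c - q 0) - int 0 * (v c - v 0)\<bar> \<le> int C + int C * (int n * fact C)"
        unfolding X_def of_nat_0 mult_zero_left diff_0_right by linarith
    qed
    ultimately show ?thesis by blast
  next
    case False
    have "\<forall>j\<in>?J. \<exists>t. (fst t \<noteq> 0 \<or> snd t \<noteq> 0) \<and> \<bar>fst t\<bar> \<le> int C \<and> \<bar>snd t\<bar> \<le> int C \<and>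
        \<bar>fst t * X i + snd t * X j\<bar> \<le> int C"
      using rel[OF i] by (simp add: X_def)
    from bchoice[OF this] obtain t where t: "\<forall>j\<in>?J. (fst (t j) \<noteq> 0 \<or> snd (t j) \<noteq> 0) \<and>
        \<bar>fst (t j)\<bar> \<le> int C \<and> \<bar>snd (t j)\<bar> \<le> int C \<and> \<bar>fst (t j) * X i + snd (t j) * X j\<bar> \<le> int C" ..
    define \<alpha> where "\<alpha> j = fst (t j)" for j
    define \<beta> where "\<beta> j = snd (t j)" for j
    have nz: "\<alpha> j \<noteq> 0 \<or> \<beta> j \<noteq> 0" and b\<alpha>: "\<bar>\<alpha> j\<bar> \<le> int C" and b\<beta>: "\<bar>\<beta> j\<bar> \<le> int C"
      and \<gamma>: "\<bar>\<alpha> j * X i + \<beta> j * X j\<bar> \<le> int C" if "j \<in> ?J" for j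
      using t that by (auto simp: \<alpha>_def \<beta>_def)
    \<comment> \<open>Since \<open>\<bar>X i\<bar>\<close> exceeds \<open>C\<close>, only the zero
      multiple of \<open>X i\<close> can be as small as \<open>C\<close>. Therefore
      \<open>\<beta> j = 0\<close> would force \<open>\<alpha> j = 0\<close>, and each relation can
      be solved for \<open>X j\<close>.\<close>
    have big: "a = 0" if "\<bar>a * X i\<bar> \<le> int C" for a
    proof (rule ccontr)
      assume "a \<noteq> 0"
      then have "1 * \<bar>X i\<bar> \<le> \<bar>a\<bar> * \<bar>X i\<bar>" by (intro mult_right_mono) auto
      then show False using that False by (simp add: abs_mult)
    qed
    have \<beta>0: "\<beta> j \<noteq> 0" if j: "j \<in> ?J" for j
    proof
      assume "\<beta> j = 0"
      then have "\<alpha> j = 0" using \<gamma>[OF j] by (intro big) simp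
      then show False using nz[OF j] \<open>\<beta> j = 0\<close> by simp
    qed
    have "\<forall>j\<in>?J. \<exists>m. F = \<beta> j * m"
    proof
      fix j assume j: "j \<in> ?J"
      have "nat \<bar>\<beta> j\<bar> dvd fact C" using \<beta>0[OF j] b\<beta>[OF j] by (intro dvd_fact) auto
      then have "int (nat \<bar>\<beta> j\<bar>) dvd int (fact C)" by (simp only: int_dvd_int_iff)
      then have "\<beta> j dvd F" by (simp add: F_def)
      then show "\<exists>m. F = \<beta> j * m" by (auto elim: dvdE)
    qed
    from bchoice[OF this] obtain m where m: "\<forall>j\<in>?J. F = \<beta> j * m j" ..
    have mF: "\<bar>m j\<bar> \<le> F" if j: "j \<in> ?J" for j
    proof -
      have "1 * \<bar>m j\<bar> \<le> \<bar>\<beta> j\<bar> * \<bar>m j\<bar>" using \<beta>0[OF j] by (intro mult_right_mono) auto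
      also have "\<dots> = F" using bspec[OF m j] F1 by (simp add: abs_mult[symmetric])
      finally show ?thesis by simp
    qed
    define T where "T = \<bar>X i\<bar>"
    define \<sigma> where "\<sigma> = sgn (X i)"
    have X\<sigma>: "X i = \<sigma> * T" by (simp add: \<sigma>_def T_def sgn_mult_abs)
    have "X i \<noteq> 0" using False by auto
    then have \<sigma>1: "\<bar>\<sigma>\<bar> = 1" by (simp add: \<sigma>_def abs_sgn_eq)
    \<comment> \<open>\<open>X i\<close> is measured in units of \<open>N\<close>: the factor
      \<open>fact C\<close> is divisible by every \<open>\<beta> j\<close>, and the factor
      \<open>n\<close> leaves room to subtract the mean of the direction without leaving the
      integers.\<close>
    define N where "N = int n * F"
    have N0: "N > 0" using n F1 by (simp add: N_def)
    define s where "s = T div N"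
    have s0: "s \<ge> 0" using N0 by (simp add: s_def T_def pos_imp_zdiv_nonneg_iff)
    define \<rho> where "\<rho> = T mod N"
    have \<rho>: "0 \<le> \<rho>" "\<rho> < N" "T = s * N + \<rho>" using N0 by (auto simp: \<rho>_def s_def)
    \<comment> \<open>Solving the relation gives \<open>X j\<close> close to
      \<open>- \<alpha> j * X i / \<beta> j\<close>. Inserting
      \<open>X i = \<sigma> * (s * N + \<rho>)\<close> and \<open>N = n * \<beta> j * m j\<close>
      yields \<open>s * n * d j\<close> up to a bounded error.\<close>
    define d where "d j = - (\<sigma> * \<alpha> j * m j)" for j
    have bd: "\<bar>d j\<bar> \<le> int C * F" if j: "j \<in> ?J" for j
    proof -
      have "\<bar>d j\<bar> = \<bar>\<alpha> j\<bar> * \<bar>m j\<bar>" using \<sigma>1 by (simp add: d_def abs_mult)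
      also have "\<dots> \<le> int C * F" by (intro mult_mono) (use b\<alpha>[OF j] mF[OF j] in auto)
      finally show ?thesis .
    qed
    have dev: "\<bar>X j - s * (int n * d j)\<bar> \<le> int C + int C * N" if j: "j \<in> ?J" for j
    proof -
      have "\<beta> j * (s * (int n * d j)) = - (s * \<sigma> * \<alpha> j * (int n * (\<beta> j * m j)))"
        by (simp add: d_def algebra_simps)
      also have "\<beta> j * m j = F" using bspec[OF m j] by simp
      finally have "\<beta> j * (X j - s * (int n * d j)) = (\<alpha> j * X i + \<beta> j * X j) - \<alpha> j * \<sigma> * \<rho>"
        unfolding right_diff_distrib X\<sigma> \<rho>(3) N_def by (simp add: algebra_simps)
      moreover have "\<bar>\<alpha> j * \<sigma> * \<rho>\<bar> \<le> int C * N"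
      proof -
        have "\<bar>\<alpha> j * \<sigma> * \<rho>\<bar> = \<bar>\<alpha> j\<bar> * \<rho>" using \<sigma>1 \<rho>(1) by (simp add: abs_mult)
        also have "\<dots> \<le> int C * N" by (intro mult_mono) (use b\<alpha>[OF j] \<rho> in auto)
        finally show ?thesis .
      qed
      ultimately have "\<bar>\<beta> j * (X j - s * (int n * d j))\<bar> \<le> int C + int C * N"
        using \<gamma>[OF j] by linarith
      moreover have "1 * \<bar>X j - s * (int n * d j)\<bar> \<le> \<bar>\<beta> j\<bar> * \<bar>X j - s * (int n * d j)\<bar>"
        using \<beta>0[OF j] by (intro mult_right_mono) auto
      ultimately show ?thesis by (simp add: abs_mult)
    qed
    \<comment> \<open>The relation of \<open>i\<close> with itself forces
      \<open>\<alpha> i = - \<beta> i\<close>, which is nonzero; so the direction does not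
      degenerate.\<close>
    have di: "d i \<noteq> 0"
    proof -
      have "\<alpha> i + \<beta> i = 0" using \<gamma>[OF i] by (intro big) (simp add: distrib_right)
      then have "\<alpha> i \<noteq> 0" using \<beta>0[OF i] by auto
      moreover have "m i \<noteq> 0" using bspec[OF m i] F1 by auto
      ultimately show ?thesis using \<sigma>1 by (auto simp: d_def)
    qed
    define S where "S = (\<Sum>j\<in>?J. d j)"
    \<comment> \<open>Subtracting the mean \<open>S\<close> of the vector with entries 0 and
      \<open>n * d c\<close> makes the sum vanish and leaves all differences
      \<open>v c - v 0\<close> unchanged.\<close>
    define v where "v c = (if c \<in> ?I then (if c = 0 then 0 else int n * d c) - S else 0)" for c
    have vJ: "v c = int n * d c - S" if "c \<in> ?J" for c using that by (auto simp: v_def)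
    have v0: "v 0 = - S" using n by (simp add: v_def)
    have bS: "\<bar>S\<bar> \<le> (int n - 1) * (int C * F)"
    proof -
      have "\<bar>S\<bar> \<le> (\<Sum>j\<in>?J. \<bar>d j\<bar>)" unfolding S_def by (rule sum_abs)
      also have "\<dots> \<le> (\<Sum>j\<in>?J. int C * F)" by (intro sum_mono bd)
      also have "\<dots> = (int n - 1) * (int C * F)" using n by simp
      finally show ?thesis .
    qed
    have "(\<Sum>c\<in>?I. v c) = v 0 + (\<Sum>c\<in>?J. v c)" unfolding I by (subst sum.insert) auto
    also have "(\<Sum>c\<in>?J. v c) = (\<Sum>c\<in>?J. int n * d c - S)" by (intro sum.cong refl vJ)
    also have "v 0 + \<dots> = 0" using n by (simp add: v0 sum_subtractf S_def flip: sum_distrib_left) (simp add: algebra_simps)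
    finally have sum0: "(\<Sum>c\<in>?I. v c) = 0" .
    have "v i - v 0 = int n * d i" using vJ[OF i] v0 by simp
    then have "v i \<noteq> v 0" using di n by auto
    then have nonzero: "\<exists>c\<in>?I. v c \<noteq> 0" using i n unfolding I by (metis insertCI)
    have bv: "\<bar>v c\<bar> \<le> 2 * int n * int C * fact C" if "c \<in> ?I" for c
    proof -
      have CF0: "0 \<le> int C * F" using CF by simp
      have "\<bar>v c\<bar> \<le> int n * (int C * F) + \<bar>S\<bar>"
      proof (cases "c = 0")
        case True
        then show ?thesis using v0 CF0 by simp
      next
        case False
        then have c: "c \<in> ?J" using that by auto
        have "\<bar>int n * d c\<bar> \<le> int n * (int C * F)"
          unfolding abs_mult by (rule mult_mono) (use bd[OF c] in auto)
        then show ?thesis unfolding vJ[OF c] by linarith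
      qed
      also have "\<dots> \<le> int n * (int C * F) + int n * (int C * F)"
        using bS CF0 unfolding left_diff_distrib by linarith
      also have "\<dots> = 2 * int n * int C * fact C" by (simp add: F_def)
      finally show ?thesis .
    qed
    have "\<bar>(q c - q 0) - int (nat s) * (v c - v 0)\<bar> \<le> int C + int C * (int n * fact C)"
      if "c \<in> ?I" for c
    proof (cases "c = 0")
      case True
      then show ?thesis by simp
    next
      case False
      then have c: "c \<in> ?J" using that by auto
      have "v c - v 0 = int n * d c" using vJ[OF c] v0 by simp
      then show ?thesis using dev[OF c] s0 by (simp add: X_def N_def F_def)
    qed
    moreover have "\<forall>c. c \<notin> ?I \<longrightarrow> v c = 0" by (simp add: v_def)
    ultimately show ?thesis using sum0 nonzero bv by blast
  qed
qed

section \<open>Finiteness of the set of base points, and the passage from 3 to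
  \<open>n\<close>\<close>

text \<open>The fixed sum rules out a large common translation: entries within \<open>D\<close> of
  \<open>w 0\<close> have their mean within \<open>D\<close> of \<open>w 0\<close>, and this mean
  lies between 0 and \<open>n\<close>.\<close>

lemma affine_perm_bounded:
  assumes w: "affine_perm n w" and n: "n > 0"
    and D: "\<And>c. c \<in> {0..<int n} \<Longrightarrow> \<bar>w c - w 0\<bar> \<le> D"
    and c: "c \<in> {0..<int n}"
  shows "\<bar>w c\<bar> \<le> int n + 2 * D"
proof -
  let ?I = "{0..<int n}"
  have "(\<Sum>c\<in>?I. w c - w 0) = (\<Sum>c\<in>?I. c) - int n * w 0"
    using w by (simp add: sum_subtractf affine_perm_iff)
  moreover have "\<bar>\<Sum>c\<in>?I. w c - w 0\<bar> \<le> int n * D"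
  proof -
    have "\<bar>\<Sum>c\<in>?I. w c - w 0\<bar> \<le> (\<Sum>c\<in>?I. \<bar>w c - w 0\<bar>)" by (rule sum_abs)
    also have "\<dots> \<le> (\<Sum>c\<in>?I. D)" by (intro sum_mono D)
    finally show ?thesis by simp
  qed
  moreover have "0 \<le> (\<Sum>c\<in>?I. c)" by (intro sum_nonneg) auto
  moreover have "(\<Sum>c\<in>?I. c) \<le> int n * int n"
  proof -
    have "(\<Sum>c\<in>?I. c) \<le> (\<Sum>c\<in>?I. int n)" by (intro sum_mono) auto
    then show ?thesis by simp
  qed
  ultimately have "\<bar>int n * w 0\<bar> \<le> int n * int n + int n * D" by linarith
  then have "int n * \<bar>w 0\<bar> \<le> int n * (int n + D)" by (simp add: abs_mult distrib_left)
  then have "\<bar>w 0\<bar> \<le> int n + D" using n by simp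
  then show ?thesis using D[OF c] by linarith
qed

lemma finite_bounded_affine_perms:
  assumes n: "n > 0"
  shows "finite {w. affine_perm n w \<and> (\<forall>c\<in>{0..<int n}. \<bar>w c\<bar> \<le> K)}"
proof -
  let ?I = "{0..<int n}"
  let ?G = "{f. \<forall>x. (x \<in> ?I \<longrightarrow> f x \<in> {- K..K}) \<and> (x \<notin> ?I \<longrightarrow> f x = 0)}"
  have "{w. affine_perm n w \<and> (\<forall>c\<in>?I. \<bar>w c\<bar> \<le> K)}
      \<subseteq> (\<lambda>f x. int n * (x div int n) + f (x mod int n)) ` ?G"
  proof
    fix w assume "w \<in> {w. affine_perm n w \<and> (\<forall>c\<in>?I. \<bar>w c\<bar> \<le> K)}"
    then have w: "affine_perm n w" and b: "\<And>c. c \<in> ?I \<Longrightarrow> \<bar>w c\<bar> \<le> K" by auto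
    let ?f = "\<lambda>x. if x \<in> ?I then w x else 0"
    have "?f \<in> ?G" using b by (auto simp: abs_le_iff minus_le_iff)
    moreover have "w = (\<lambda>x. int n * (x div int n) + ?f (x mod int n))"
    proof
      fix x
      have "x mod int n \<in> ?I" using n by simp
      then show "w x = int n * (x div int n) + ?f (x mod int n)"
        using periodic_window[of w n x, OF periodic_bijD(2)[OF affine_perm_periodic_bij[OF w]]] by simp
    qed
    ultimately show "w \<in> (\<lambda>f x. int n * (x div int n) + f (x mod int n)) ` ?G" 
      by (intro image_eqI)
  qed
  moreover have "finite ?G" by (rule finite_set_of_finite_funs) auto
  ultimately show ?thesis by (rule finite_subset[OF _ finite_imageI])
qed

text \<open>Periodicity for 3 enters the counting argument through this bound. Every later
  coefficient repeats one with index below \<open>i0 + N\<close>, and a sum of naturals bounds each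
  summand.\<close>

lemma periodic_for_bounded:
  assumes "periodic_for p n"
  shows "\<exists>B. \<forall>i. avoid_coeff p n i \<le> B"
proof -
  obtain N i0 where N: "N \<ge> 1" "\<And>i. i \<ge> i0 \<Longrightarrow> avoid_coeff p n (i + N) = avoid_coeff p n i"
    using assms unfolding periodic_for_def by blast
  define B where "B = (\<Sum>i<i0 + N. avoid_coeff p n i)"
  have "avoid_coeff p n i \<le> B" for i
  proof (induction i rule: less_induct)
    case (less i)
    show ?case
    proof (cases "i < i0 + N")
      case True
      then show ?thesis unfolding B_def by (intro member_le_sum) auto
    next
      case False
      then have "avoid_coeff p n i = avoid_coeff p n (i - N)" using N(2)[of "i - N"] by simp
      then show ?thesis using less.IH[of "i - N"] False N(1) by simp
    qed
  qed
  then show ?thesis by blast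
qed

theorem mainTheorem15:
  fixes n :: nat and p :: "nat list"
  assumes "n > 3" and "is_pattern p" and "periodic_for p 3"
  shows "periodic_for p n"
proof -
  have p: "distinct p" using assms(2) by (simp add: is_pattern_def)
  have n: "n \<ge> 2" "n > 0" using assms(1) by auto
  let ?I = "{0..<int n}"
  obtain B where B: "\<And>i. avoid_coeff p 3 i \<le> B" using periodic_for_bounded[OF assms(3)] by blast
  obtain C' where C': "C' \<ge> 1" "\<And>w. periodic_bij 3 w \<Longrightarrow> avoids w p \<Longrightarrow>
      \<exists>\<alpha> \<beta>. (\<alpha> \<noteq> 0 \<or> \<beta> \<noteq> 0) \<and> \<bar>\<alpha>\<bar> \<le> C' \<and> \<bar>\<beta>\<bar> \<le> C' \<and>
       \<bar>\<alpha> * (w 1 div 3 - w 0 div 3) + \<beta> * (w 2 div 3 - w 0 div 3)\<bar> \<le> C'"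
    using periodic_bij_3_relation[OF p B] by blast
  define C where "C = nat C'"
  have C: "C \<ge> 1" "int C = C'" using C'(1) by (auto simp: C_def)
  define K2 where "K2 = int C + int C * (int n * fact C)"
  \<comment> \<open>The first summand bounds the entries of the direction. The second is the bound
    of \<open>affine_perm_bounded\<close> for deviations of at most \<open>n * K2 + n\<close>, where
    \<open>K2\<close> controls the quotients and the last \<open>n\<close> the residues.\<close>
  define K where "K = 2 * int n * int C * fact C + (int n + 2 * (int n * K2 + int n))"
  have K2: "K2 \<ge> 0" by (simp add: K2_def)
  have Kv: "2 * int n * int C * fact C \<le> K" using K2 by (simp add: K_def)
  have Kw: "int n + 2 * (int n * K2 + int n) \<le> K" by (simp add: K_def)
  \<comment> \<open>The finite set of rays, independent of the avoider; directions are required to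
    vanish outside the window so that bounded entries leave only finitely many of them.\<close>
  define R where "R = {w. affine_perm n w \<and> (\<forall>c\<in>?I. \<bar>w c\<bar> \<le> K)} \<times>
    {v. (\<forall>x. (x \<in> ?I \<longrightarrow> v x \<in> {- K..K}) \<and> (x \<notin> ?I \<longrightarrow> v x = 0)) \<and>
        (\<Sum>c\<in>?I. v c) = 0 \<and> (\<exists>c\<in>?I. v c \<noteq> 0)}"
  have "finite {v. \<forall>x. (x \<in> ?I \<longrightarrow> v x \<in> {- K..K}) \<and> (x \<notin> ?I \<longrightarrow> v x = (0::int))}"
    by (rule finite_set_of_finite_funs) auto
  then have "finite R"
    unfolding R_def by (intro finite_cartesian_product finite_bounded_affine_perms[OF n(2)])
      (rule finite_subset[rotated], auto)
  then show ?thesis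
  proof (rule periodic_for_if_covered_by_rays[OF n(1) p])
    show "affine_perm n w" if "(w, v) \<in> R" for w v using that by (simp add: R_def)
    show "(\<Sum>i\<in>?I. v i) = 0 \<and> (\<exists>i\<in>?I. v i \<noteq> 0)" if "(w, v) \<in> R" for w v
      using that by (simp add: R_def)
    fix w assume w: "affine_perm n w" and av: "avoids w p"
    have pw: "periodic_bij n w" using w by (rule affine_perm_periodic_bij)
    define q where "q c = w c div int n" for c
    have rel_lt: "\<exists>\<alpha> \<beta>. (\<alpha> \<noteq> 0 \<or> \<beta> \<noteq> 0) \<and> \<bar>\<alpha>\<bar> \<le> int C \<and> \<bar>\<beta>\<bar> \<le> int C \<and>
        \<bar>\<alpha> * (q i - q 0) + \<beta> * (q j - q 0)\<bar> \<le> int C"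
      if "0 < i" "i < j" "j < int n" for i j
    proof -
      from restrict_to_three_classes[OF pw n(2) that]
      obtain u where u: "periodic_bij 3 u" "u 0 div 3 = q 0" "u 1 div 3 = q i" "u 2 div 3 = q j"
        "contains u p \<longrightarrow> contains w p" unfolding q_def by blast
      have "avoids u p" using av u(5) by (auto simp: avoids_def)
      from C'(2)[OF u(1) this] show ?thesis unfolding u(2-4) C(2) .
    qed
    \<comment> \<open>Classes in the opposite order exchange the two coefficients, and a class
      paired with itself satisfies the trivial relation with coefficients 1 and -1.\<close>
    have rel: "\<exists>\<alpha> \<beta>. (\<alpha> \<noteq> 0 \<or> \<beta> \<noteq> 0) \<and> \<bar>\<alpha>\<bar> \<le> int C \<and> \<bar>\<beta>\<bar> \<le> int C \<and>
        \<bar>\<alpha> * (q i - q 0) + \<beta> * (q j - q 0)\<bar> \<le> int C"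
      if ij: "i \<in> {1..<int n}" "j \<in> {1..<int n}" for i j
    proof -
      consider "i < j" | "i = j" | "j < i" by linarith
      then show ?thesis
      proof cases
        case 1
        then show ?thesis using rel_lt[of i j] ij by simp
      next
        case 2
        then show ?thesis using C(1) by (intro exI[of _ 1] exI[of _ "- 1"]) simp
      next
        case 3
        then obtain \<alpha> \<beta> where "\<alpha> \<noteq> 0 \<or> \<beta> \<noteq> 0" "\<bar>\<alpha>\<bar> \<le> int C" "\<bar>\<beta>\<bar> \<le> int C"
          "\<bar>\<alpha> * (q j - q 0) + \<beta> * (q i - q 0)\<bar> \<le> int C"
          using rel_lt[of j i] ij by auto
        then show ?thesis by (intro exI[of _ \<beta>] exI[of _ \<alpha>]) (auto simp: add.commute)
      qed
    qed
    from bounded_relations_line[of n C q, OF n(1) C(1) rel]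
    obtain v s where v: "(\<Sum>c\<in>?I. v c) = 0" "\<exists>c\<in>?I. v c \<noteq> 0" "\<forall>c. c \<notin> ?I \<longrightarrow> v c = 0"
      "\<forall>c\<in>?I. \<bar>v c\<bar> \<le> 2 * int n * int C * fact C"
      "\<forall>c\<in>?I. \<bar>(q c - q 0) - int s * (v c - v 0)\<bar> \<le> K2"
      unfolding K2_def by blast
    \<comment> \<open>Going back \<open>s\<close> steps from \<open>w\<close> along \<open>v\<close>
      removes the unbounded part of the quotient differences, so the starting point lies in the
      finite set of base points.\<close>
    define w0 where "w0 = ray n w v (- int s)"
    have w0: "affine_perm n w0" unfolding w0_def by (rule affine_perm_ray[OF w n(2) v(1)])
    have "w = ray n w0 v (int s)" by (simp add: w0_def ray_def fun_eq_iff)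
    moreover have "(w0, v) \<in> R"
    proof -
      have "\<bar>w0 c - w0 0\<bar> \<le> int n * K2 + int n" if c: "c \<in> ?I" for c
      proof -
        define t where "t = (q c - q 0) - int s * (v c - v 0)"
        have wq: "w x = int n * q x + w x mod int n" for x by (simp add: q_def)
        have "w0 c - w0 0 = int n * t + (w c mod int n - w 0 mod int n)"
          using c wq[of c] wq[of 0] by (simp add: w0_def ray_def t_def algebra_simps)
        moreover have "\<bar>int n * t\<bar> \<le> int n * K2"
          unfolding abs_mult using v(5) c by (simp add: t_def mult_left_mono)
        moreover have "\<bar>w c mod int n - w 0 mod int n\<bar> \<le> int n"
        proof -
          have "0 \<le> w c mod int n" "w c mod int n < int n" "0 \<le> w 0 mod int n" "w 0 mod int n < int n"
            using n by auto
          then show ?thesis by linarith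
        qed
        ultimately show ?thesis by linarith
      qed
      from affine_perm_bounded[OF w0 n(2) this]
      have "\<forall>c\<in>?I. \<bar>w0 c\<bar> \<le> K" using Kw by fastforce
      moreover have "v x \<in> {- K..K}" if "x \<in> ?I" for x
      proof -
        have "\<bar>v x\<bar> \<le> K" using v(4) that Kv by fastforce
        then show ?thesis by (simp add: abs_le_iff minus_le_iff)
      qed
      ultimately show ?thesis using w0 v(1-3) unfolding R_def by blast
    qed
    ultimately show "\<exists>(w0, v)\<in>R. \<exists>s::nat. w = ray n w0 v (int s)" by blast
  qed
qed

end
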